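(* There exist absolute constants $c,C>0$ such that for every $\alpha>2$ and every integer $n\ge 1$, $$R_{\mathrm{UM}}(\alpha,n)\ \le\ R_2(\alpha,n)\ \le\ C\,n^{1-\frac{c}{\alpha}}.$$
   Context: For an injective map $f:X\to Y$ between metric spaces, its distortion is $\mathrm{dist}(f)=\sup_{x\ne y}\frac{d_Y(f(x),f(y))}{d_X(x,y)}\cdot\sup_{x\neq y}\frac{d_X(x,y)}{d_Y(f(x),f(y))}$ (equal to $1$ if $|X|=1$). $c_Y(X)$ is the least distortion (infimum) of an embedding of $X$ into $Y$; for a class $\mathcal M$ of metric spaces, $c_{\mathcal M}(X)=\inf_{Y\in\mathcal M}c_Y(X)$. $X$ is said to $\alpha$-embed into $\mathcal M$ if $c_{\mathcal M}(X)\le\alpha$. $R_{\mathcal M}(\alpha,n)$ is the largest integer $m$ such that every $n$-point metric space has a subspace of size $m$ that $\alpha$-embeds into a member of $\mathcal M$. $R_2=R_{\{\ell_2\}}$. $\mathrm{UM}$ is the class of ultrametric spaces, i.e. metric spaces with $d(x,z)\le\max\{d(x,y),d(y,z)\}$ for all $x,y,z$. *)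

theory Defs
  imports "HOL-Analysis.Analysis"
begin

text \<open>
  Distortions are extended nonnegative reals, so that the suprema and infima below are the
  true ones: a supremum may be infinite, and the infimum over no embeddings is infinite.
  The product of the suprema is used whenever the space has two distinct points; otherwise
  the suprema range over the empty set and the distortion is set to 1.
\<close>

definition expansion :: "'a metric \<Rightarrow> 'b metric \<Rightarrow> ('a \<Rightarrow> 'b) \<Rightarrow> ennreal" where
  "expansion X Y f =
     (SUP (x, y) \<in> {(x, y). x \<in> mspace X \<and> y \<in> mspace X \<and> x \<noteq> y}.
        ennreal (mdist Y (f x) (f y) / mdist X x y))"

definition contraction :: "'a metric \<Rightarrow> 'b metric \<Rightarrow> ('a \<Rightarrow> 'b) \<Rightarrow> ennreal" where
  "contraction X Y f =
     (SUP (x, y) \<in> {(x, y). x \<in> mspace X \<and> y \<in> mspace X \<and> x \<noteq> y}.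
        ennreal (mdist X x y / mdist Y (f x) (f y)))"

definition distortion :: "'a metric \<Rightarrow> 'b metric \<Rightarrow> ('a \<Rightarrow> 'b) \<Rightarrow> ennreal" where
  "distortion X Y f =
     (if \<exists>x\<in>mspace X. \<exists>y\<in>mspace X. x \<noteq> y then expansion X Y f * contraction X Y f else 1)"

definition embeddings :: "'a metric \<Rightarrow> 'b metric \<Rightarrow> ('a \<Rightarrow> 'b) set" where
  "embeddings X Y = {f. inj_on f (mspace X) \<and> f ` mspace X \<subseteq> mspace Y}"

definition least_distortion :: "'b metric \<Rightarrow> 'a metric \<Rightarrow> ennreal" where
  "least_distortion Y X = (INF f \<in> embeddings X Y. distortion X Y f)"

definition least_distortion_class :: "'b metric set \<Rightarrow> 'a metric \<Rightarrow> ennreal" where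
  "least_distortion_class \<M> X = (INF Y \<in> \<M>. least_distortion Y X)"

definition embeds_class :: "real \<Rightarrow> 'a metric \<Rightarrow> 'b metric set \<Rightarrow> bool" where
  "embeds_class \<alpha> X \<M> \<longleftrightarrow> least_distortion_class \<M> X \<le> ennreal \<alpha>"

text \<open>
  Embedding into a member \<open>Y\<close> of the class is embedding into the class \<open>{Y}\<close>; the infimum over
  maps need not be attained, but a single target \<open>Y\<close> must serve.
\<close>

definition has_embedding_subspace :: "'b metric set \<Rightarrow> real \<Rightarrow> nat \<Rightarrow> 'a metric \<Rightarrow> bool" where
  "has_embedding_subspace \<M> \<alpha> m X \<longleftrightarrow>
     (\<exists>S \<subseteq> mspace X. card S = m \<and> (\<exists>Y\<in>\<M>. embeds_class \<alpha> (submetric X S) {Y}))"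

text \<open>
  Finite metric spaces are taken with points in \<^typ>\<open>nat\<close>; up to isometry these are all of
  them (lemma \<open>has_embedding_subspace_universe\<close> below).
\<close>

definition metric_Ramsey :: "'b metric set \<Rightarrow> real \<Rightarrow> nat \<Rightarrow> nat" where
  "metric_Ramsey \<M> \<alpha> n =
     (GREATEST m. \<forall>X :: nat metric. finite (mspace X) \<and> card (mspace X) = n
        \<longrightarrow> has_embedding_subspace \<M> \<alpha> m X)"

definition ultrametrics :: "'a metric set" where
  "ultrametrics = {Y. \<forall>x\<in>mspace Y. \<forall>y\<in>mspace Y. \<forall>z\<in>mspace Y.
                        mdist Y x z \<le> max (mdist Y x y) (mdist Y y z)}"

text \<open>
  The points of an ultrametric space are likewise taken in \<^typ>\<open>nat\<close>; lemma
  \<open>ultrametrics_universe\<close> below shows that no larger universe changes \<open>\<alpha>\<close>-embeddability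
  of finite spaces.
\<close>

abbreviation UM :: "nat metric set" where
  "UM \<equiv> ultrametrics"

definition l2 :: "(nat \<Rightarrow> real) metric" where
  "l2 = metric ({x. (\<lambda>i. (x i)\<^sup>2) summable_on UNIV}, \<lambda>x y. sqrt (\<Sum>\<^sub>\<infinity>i. (x i - y i)\<^sup>2))"


section \<open>The sequence space is a metric space\<close>

lemma l2_summable_diff:
  fixes x y :: "nat \<Rightarrow> real"
  assumes "(\<lambda>i. (x i)\<^sup>2) summable_on UNIV" "(\<lambda>i. (y i)\<^sup>2) summable_on UNIV"
  shows "(\<lambda>i. (x i - y i)\<^sup>2) summable_on UNIV"
proof (rule summable_on_comparison_test)
  show "(\<lambda>i. 2 * (x i)\<^sup>2 + 2 * (y i)\<^sup>2) summable_on UNIV"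
    using assms by (intro summable_on_add summable_on_cmult_right)
  show "(x i - y i)\<^sup>2 \<le> 2 * (x i)\<^sup>2 + 2 * (y i)\<^sup>2" for i
    using zero_le_power2[of "x i + y i"] by (simp add: power2_eq_square algebra_simps)
qed auto

lemma Metric_space_l2:
  "Metric_space {x. (\<lambda>i. (x i)\<^sup>2) summable_on UNIV}
     (\<lambda>x y :: nat \<Rightarrow> real. sqrt (\<Sum>\<^sub>\<infinity>i. (x i - y i)\<^sup>2))"
proof
  fix x y z :: "nat \<Rightarrow> real"
  show "0 \<le> sqrt (\<Sum>\<^sub>\<infinity>i. (x i - y i)\<^sup>2)"
    by (simp add: infsum_nonneg)
  show "sqrt (\<Sum>\<^sub>\<infinity>i. (x i - y i)\<^sup>2) = sqrt (\<Sum>\<^sub>\<infinity>i. (y i - x i)\<^sup>2)"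
    by (simp add: power2_commute)
  assume x: "x \<in> {x. (\<lambda>i. (x i)\<^sup>2) summable_on UNIV}"
     and y: "y \<in> {x. (\<lambda>i. (x i)\<^sup>2) summable_on UNIV}"
  have xy: "(\<lambda>i. (x i - y i)\<^sup>2) summable_on UNIV"
    using x y by (simp add: l2_summable_diff)
  show "sqrt (\<Sum>\<^sub>\<infinity>i. (x i - y i)\<^sup>2) = 0 \<longleftrightarrow> x = y"
  proof
    assume "sqrt (\<Sum>\<^sub>\<infinity>i. (x i - y i)\<^sup>2) = 0"
    then have "(x i - y i)\<^sup>2 = 0" for i
      using nonneg_infsum_le_0D[of "\<lambda>i. (x i - y i)\<^sup>2" UNIV i] xy by auto
    then show "x = y" by auto
  qed simp
  assume z: "z \<in> {x. (\<lambda>i. (x i)\<^sup>2) summable_on UNIV}"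
  have yz: "(\<lambda>i. (y i - z i)\<^sup>2) summable_on UNIV"
    and xz: "(\<lambda>i. (x i - z i)\<^sup>2) summable_on UNIV"
    using x y z by (simp_all add: l2_summable_diff)
  let ?b = "sqrt (\<Sum>\<^sub>\<infinity>i. (x i - y i)\<^sup>2) + sqrt (\<Sum>\<^sub>\<infinity>i. (y i - z i)\<^sup>2)"
  have b0: "0 \<le> ?b" by (simp add: infsum_nonneg)
  have "(\<Sum>\<^sub>\<infinity>i. (x i - z i)\<^sup>2) \<le> ?b\<^sup>2"
  proof (rule infsum_le_finite_sums[OF xz])
    fix F :: "nat set" assume F: "finite F" "F \<subseteq> UNIV"
    have "L2_set (\<lambda>i. x i - z i) F = L2_set (\<lambda>i. (x i - y i) + (y i - z i)) F"
      by simp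
    also have "\<dots> \<le> L2_set (\<lambda>i. x i - y i) F + L2_set (\<lambda>i. y i - z i) F"
      by (rule L2_set_triangle_ineq)
    also have "\<dots> \<le> ?b"
      unfolding L2_set_def using F xy yz
      by (intro add_mono real_sqrt_le_mono finite_sum_le_infsum) auto
    finally have "(L2_set (\<lambda>i. x i - z i) F)\<^sup>2 \<le> ?b\<^sup>2"
      by (intro power_mono) auto
    then show "(\<Sum>i\<in>F. (x i - z i)\<^sup>2) \<le> ?b\<^sup>2"
      by (simp add: L2_set_def sum_nonneg)
  qed
  then show "sqrt (\<Sum>\<^sub>\<infinity>i. (x i - z i)\<^sup>2) \<le> ?b"
    using b0 by (intro real_le_lsqrt)
qed

lemma mspace_l2: "mspace l2 = {x. (\<lambda>i. (x i)\<^sup>2) summable_on UNIV}"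
  and mdist_l2: "mdist l2 x y = sqrt (\<Sum>\<^sub>\<infinity>i. (x i - y i)\<^sup>2)"
  unfolding l2_def
  by (simp_all add: Metric_space.mspace_metric[OF Metric_space_l2]
        Metric_space.mdist_metric[OF Metric_space_l2])


section \<open>Independence of the universes\<close>

lemma Metric_space_pullback:
  assumes "inj_on g D" "g ` D \<subseteq> mspace X"
  shows "Metric_space D (\<lambda>x y. mdist X (g x) (g y))"
proof
  show "mdist X (g x) (g y) = mdist X (g y) (g x)" for x y
    by (rule mdist_commute)
  show "mdist X (g x) (g y) = 0 \<longleftrightarrow> x = y" if "x \<in> D" "y \<in> D" for x y
    using assms that by (metis image_subset_iff inj_onD mdist_zero)
  show "mdist X (g x) (g z) \<le> mdist X (g x) (g y) + mdist X (g y) (g z)"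
    if "x \<in> D" "y \<in> D" "z \<in> D" for x y z
    using assms that by (intro mdist_triangle) auto
qed simp

lemma distortion_cong_domain:
  assumes bij: "bij_betw g (mspace X') (mspace X)"
    and iso: "\<And>x y. x \<in> mspace X' \<Longrightarrow> y \<in> mspace X' \<Longrightarrow> mdist X' x y = mdist X (g x) (g y)"
  shows "distortion X' Y (f \<circ> g) = distortion X Y f"
proof -
  let ?P' = "{(x, y). x \<in> mspace X' \<and> y \<in> mspace X' \<and> x \<noteq> y}"
  let ?P = "{(x, y). x \<in> mspace X \<and> y \<in> mspace X \<and> x \<noteq> y}"
  have inj: "inj_on g (mspace X')" and im: "g ` mspace X' = mspace X"
    using bij by (auto simp: bij_betw_def)
  have P: "?P = map_prod g g ` ?P'"
  proof (intro equalityI subsetI)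
    fix p assume "p \<in> ?P"
    then obtain a b where "a \<in> mspace X'" "b \<in> mspace X'" "g a \<noteq> g b" "p = (g a, g b)"
      by (auto simp flip: im)
    then show "p \<in> map_prod g g ` ?P'"
      by (intro image_eqI[of _ _ "(a, b)"]) auto
  qed (use im in \<open>auto dest: inj_onD[OF inj]\<close>)
  have e: "expansion X' Y (f \<circ> g) = expansion X Y f"
    unfolding expansion_def P image_image by (intro SUP_cong) (auto simp: iso)
  have c: "contraction X' Y (f \<circ> g) = contraction X Y f"
    unfolding contraction_def P image_image by (intro SUP_cong) (auto simp: iso)
  have ne: "(\<exists>x\<in>mspace X'. \<exists>y\<in>mspace X'. x \<noteq> y) \<longleftrightarrow> (\<exists>x\<in>mspace X. \<exists>y\<in>mspace X. x \<noteq> y)"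
    unfolding im[symmetric] bex_simps by (intro bex_cong refl) (simp add: inj_on_eq_iff[OF inj])
  show ?thesis
    by (simp add: distortion_def e c ne)
qed

lemma least_distortion_isometry_le:
  assumes bij: "bij_betw g (mspace X') (mspace X)"
    and iso: "\<And>x y. x \<in> mspace X' \<Longrightarrow> y \<in> mspace X' \<Longrightarrow> mdist X' x y = mdist X (g x) (g y)"
  shows "least_distortion Y X' \<le> least_distortion Y X"
  unfolding least_distortion_def
proof (rule INF_mono)
  fix f assume f: "f \<in> embeddings X Y"
  then have "f \<circ> g \<in> embeddings X' Y"
    using bij by (auto simp: embeddings_def bij_betw_def intro: comp_inj_on)
  then show "\<exists>h\<in>embeddings X' Y. distortion X' Y h \<le> distortion X Y f"
    using distortion_cong_domain[OF bij iso] by (metis order_refl)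
qed

lemma has_embedding_subspace_universe:
  assumes "\<And>X :: nat metric. finite (mspace X) \<Longrightarrow> card (mspace X) = n
             \<Longrightarrow> has_embedding_subspace \<M> \<alpha> m X"
    and fin: "finite (mspace Z)" and card: "card (mspace Z) = n"
  shows "has_embedding_subspace \<M> \<alpha> m (Z :: 'a metric)"
proof -
  obtain g where g: "bij_betw g {..<n} (mspace Z)"
    using bij_betw_from_nat_into_finite[OF fin] card by auto
  define X where "X = metric ({..<n}, \<lambda>x y. mdist Z (g x) (g y))"
  have M: "Metric_space {..<n} (\<lambda>x y. mdist Z (g x) (g y))"
    using g by (intro Metric_space_pullback) (auto simp: bij_betw_def)
  have X: "mspace X = {..<n}" "mdist X = (\<lambda>x y. mdist Z (g x) (g y))"
    unfolding X_def by (simp_all add: Metric_space.mspace_metric[OF M] Metric_space.mdist_metric[OF M])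
  obtain S Y where S: "S \<subseteq> {..<n}" "card S = m" and Y: "Y \<in> \<M>"
    and e: "embeds_class \<alpha> (submetric X S) {Y}"
    using assms(1)[of X] X unfolding has_embedding_subspace_def by auto
  have bS: "bij_betw g S (g ` S)" and gS: "g ` S \<subseteq> mspace Z"
    using g S(1) by (auto simp: bij_betw_def intro: inj_on_subset)
  let ?h = "inv_into S g"
  have bh: "bij_betw ?h (mspace (submetric Z (g ` S))) (mspace (submetric X S))"
    using bij_betw_inv_into[OF bS] gS S(1) X by (simp add: Int_absorb2)
  have "least_distortion Y (submetric Z (g ` S)) \<le> least_distortion Y (submetric X S)"
    by (rule least_distortion_isometry_le[OF bh])
      (auto simp: X f_inv_into_f)
  then have "embeds_class \<alpha> (submetric Z (g ` S)) {Y}"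
    using e by (auto simp: embeds_class_def least_distortion_class_def)
  moreover have "card (g ` S) = m"
    using bS S(2) by (metis bij_betw_same_card)
  ultimately show ?thesis
    unfolding has_embedding_subspace_def using gS Y by blast
qed

lemma ultrametrics_universe:
  fixes X :: "'a metric" and Y :: "'b metric"
  assumes fin: "finite (mspace X)" and Y: "Y \<in> ultrametrics" and e: "embeds_class \<alpha> X {Y}"
  shows "\<exists>Y' \<in> UM. embeds_class \<alpha> X {Y'}"
proof -
  have le: "least_distortion Y X \<le> ennreal \<alpha>"
    using e by (simp add: embeds_class_def least_distortion_class_def)
  then have "embeddings X Y \<noteq> {}"
    by (auto simp: least_distortion_def top_unique)
  then obtain q :: "nat \<Rightarrow> ennreal" where q: "range q \<subseteq> distortion X Y ` embeddings X Y"
    "least_distortion Y X = (INF i. q i)"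
    unfolding least_distortion_def
    using ennreal_Inf_countable_INF[of "distortion X Y ` embeddings X Y"] by auto
  have "\<exists>f. f \<in> embeddings X Y \<and> q i = distortion X Y f" for i
    using q(1) by auto
  then obtain f where f: "\<And>i. f i \<in> embeddings X Y" "\<And>i. q i = distortion X Y (f i)"
    by metis
  define T where "T = (\<Union>i. f i ` mspace X)"
  have cT: "countable T"
    unfolding T_def using fin by (auto intro: countable_finite)
  have TY: "T \<subseteq> mspace Y"
    using f(1) by (auto simp: T_def embeddings_def)
  define D where "D = to_nat_on T ` T"
  define g where "g = from_nat_into T"
  have gt: "g (to_nat_on T t) = t" if "t \<in> T" for t
    using cT that by (simp add: g_def)
  have gD: "inj_on g D" "g ` D \<subseteq> mspace Y"
    using TY gt by (auto simp: D_def inj_on_def)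
  define Y' where "Y' = metric (D, \<lambda>x y. mdist Y (g x) (g y))"
  note M = Metric_space_pullback[OF gD]
  have Y': "mspace Y' = D" "mdist Y' = (\<lambda>x y. mdist Y (g x) (g y))"
    unfolding Y'_def by (simp_all add: Metric_space.mspace_metric[OF M] Metric_space.mdist_metric[OF M])
  have "Y' \<in> UM"
    using Y gD(2) by (auto simp: ultrametrics_def Y' image_subset_iff)
  moreover have "least_distortion Y' X \<le> q i" for i
  proof -
    let ?h = "to_nat_on T \<circ> f i"
    have inT: "f i x \<in> T" if "x \<in> mspace X" for x
      using that by (auto simp: T_def)
    have "?h \<in> embeddings X Y'"
      using f(1)[of i] inT gt
      by (auto simp: embeddings_def Y' D_def inj_on_def) (metis gt)
    moreover have "expansion X Y' ?h = expansion X Y (f i)"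
      unfolding expansion_def by (intro SUP_cong) (auto simp: Y' gt inT)
    moreover have "contraction X Y' ?h = contraction X Y (f i)"
      unfolding contraction_def by (intro SUP_cong) (auto simp: Y' gt inT)
    ultimately show ?thesis
      unfolding least_distortion_def f(2) by (intro INF_lower2) (auto simp: distortion_def)
  qed
  then have "least_distortion Y' X \<le> least_distortion Y X"
    unfolding q(2) by (rule INF_greatest)
  ultimately show ?thesis
    using le by (intro bexI[of _ Y']) (auto simp: embeds_class_def least_distortion_class_def)
qed

end

theory Submission
  imports Defs
begin

text \<open>
  The inequality between the two Ramsey functions holds because a finite ultrametric space is
  isometric to a subset of Hilbert space (\<open>finite_ultrametric_into_l2\<close>): the squared distance is a
  nonnegative combination of the 0-1 valued functions \<open>d x y > t\<close>, each of which separates the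
  classes of an equivalence relation, and putting the classes on orthogonal vectors realises it.

  For the upper bound, the hard spaces come from expander graphs. There is a metric \<open>\<rho>\<close> on
  \<open>N = 65536 ^ s\<close> points such that no subset with more than three quarters of the points embeds
  in Hilbert space with distortion below \<open>s / 20\<close>, which is of the order of \<open>ln N\<close>
  (\<open>exists_l2_resistant_metric\<close>). It is a Cayley metric on the group of subsets of a set with
  \<open>16 * s\<close> elements, under symmetric difference, with \<open>64 * s\<close> random generators. Every nontrivial
  character is \<open>-1\<close> on at least an eighth of them (\<open>exists_generators\<close>), so Parseval's
  identity gives a Poincare inequality: for each function, the mean squared difference over all pairs
  is at most four times the one over the edges. This extends to Hilbert-valued functions coordinate by
  coordinate. On the other hand a ball of radius \<open>s\<close> contains at most a quarter of the points,
  so most pairs are far apart, and a map with bounded stretch on the edges must contract them.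

  A large subset \<open>S\<close> need not contain any edges. A map on \<open>S\<close> is therefore extended to all
  points by composing it with a nearest-point map onto \<open>S\<close>. This costs an additive error given by the
  distance to \<open>S\<close>, and that distance is itself a 1-Lipschitz function vanishing on \<open>S\<close>; the same
  Poincare inequality bounds its mean square by a constant (\<open>l2_resistant_if_poincare\<close>).

  To have large spaces with a given distortion, \<open>\<rho>\<close> is placed on the digits of the natural
  numbers in base \<open>N\<close>: two numbers are at distance \<open>\<beta> ^ l\<close> times the \<open>\<rho>\<close>-distance of their
  leading differing digits, at position \<open>l\<close>. In a subset that embeds well, the numbers with a common
  prefix use at most three quarters of the digits at the next position, because choosing one number
  for each digit gives a scaled copy of a subset of \<open>\<rho>\<close>. Hence it contains at most a proportion of
  \<open>(3 / 4) ^ k\<close> of a block of \<open>N ^ k\<close> numbers. With \<open>s\<close> proportional to \<open>\<alpha>\<close> and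
  \<open>k\<close> about \<open>ln n / ln N\<close>, this proportion is of the order of \<open>n powr (- c / \<alpha>)\<close>.
  Rounding \<open>n\<close> up to whole blocks costs a constant factor.
\<close>

section \<open>Finite ultrametric spaces are Euclidean\<close>

text \<open>
  Stated for the squared distance \<open>u\<close>, which satisfies the ultrametric inequality as well and, unlike
  the distance, adds up under orthogonal sums. Zero values between distinct points are admitted so
  that the least positive value \<open>t\<close> can be subtracted: \<open>u\<close> is \<open>t\<close> times the indicator of \<open>u x y > 0\<close>
  plus a function with fewer positive values. By the ultrametric inequality \<open>u x y = 0\<close> is an
  equivalence relation, so the indicator is realised by multiples of unit vectors, one for each class.
\<close>

lemma finite_ultrametric_into_Euclidean:
  fixes u :: "nat \<Rightarrow> nat \<Rightarrow> real"
  assumes X: "finite X"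
    and nonneg: "\<And>x y. x \<in> X \<Longrightarrow> y \<in> X \<Longrightarrow> 0 \<le> u x y"
    and refl: "\<And>x. x \<in> X \<Longrightarrow> u x x = 0"
    and sym: "\<And>x y. x \<in> X \<Longrightarrow> y \<in> X \<Longrightarrow> u x y = u y x"
    and ultra: "\<And>x y z. x \<in> X \<Longrightarrow> y \<in> X \<Longrightarrow> z \<in> X \<Longrightarrow> u x z \<le> max (u x y) (u y z)"
  shows "\<exists>K (f :: nat \<Rightarrow> nat \<Rightarrow> real). \<forall>x\<in>X. \<forall>y\<in>X. u x y = (\<Sum>i<K. (f x i - f y i)\<^sup>2)"
  using nonneg refl sym ultra
proof (induction "card {r. r > 0 \<and> (\<exists>x\<in>X. \<exists>y\<in>X. r = u x y)}" arbitrary: u rule: less_induct)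
  case less
  let ?R = "\<lambda>u :: nat \<Rightarrow> nat \<Rightarrow> real. {r. r > 0 \<and> (\<exists>x\<in>X. \<exists>y\<in>X. r = u x y)}"
  have finR: "finite (?R v)" for v
    by (rule finite_subset[of _ "(\<lambda>(x, y). v x y) ` (X \<times> X)"]) (use X in auto)
  show ?case
  proof (cases "?R u = {}")
    case True
    then have "u x y = 0" if "x \<in> X" "y \<in> X" for x y
      using less.prems(1)[OF that] that by (auto simp: less_le)
    then show ?thesis by (intro exI[of _ 0]) auto
  next
    case False
    define t where "t = Min (?R u)"
    have t: "t \<in> ?R u" unfolding t_def using finR False by (rule Min_in)
    have tle: "t \<le> u x y" if "x \<in> X" "y \<in> X" "u x y \<noteq> 0" for x y
      unfolding t_def using that less.prems(1)[OF that(1,2)] finR by (intro Min_le) auto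
    define v where "v x y = max 0 (u x y - t)" for x y
    have "?R v \<subseteq> (\<lambda>r. r - t) ` (?R u - {t})"
    proof
      fix r assume "r \<in> ?R v"
      then obtain x y where xy: "r > 0" "x \<in> X" "y \<in> X" "r = v x y" by auto
      then have "u x y = r + t" by (auto simp: v_def max_def split: if_splits)
      then show "r \<in> (\<lambda>r. r - t) ` (?R u - {t})"
        using xy t by (intro image_eqI[of _ _ "r + t"]) (simp, metis (mono_tags, lifting) CollectD
            CollectI DiffI add_pos_pos less_add_same_cancel2 less_irrefl singletonD)
    qed
    then have "card (?R v) \<le> card (?R u - {t})"
      using finR by (intro surj_card_le) auto
    also have "\<dots> < card (?R u)"
      using t finR by (intro card_Diff1_less) auto
    finally have lt: "card (?R v) < card (?R u)" .
    obtain K and f :: "nat \<Rightarrow> nat \<Rightarrow> real" where f: "\<And>x y. x \<in> X \<Longrightarrow> y \<in> X \<Longrightarrow> v x y = (\<Sum>i<K. (f x i - f y i)\<^sup>2)"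
    proof -
      have "\<exists>K (f :: nat \<Rightarrow> nat \<Rightarrow> real). \<forall>x\<in>X. \<forall>y\<in>X. v x y = (\<Sum>i<K. (f x i - f y i)\<^sup>2)"
      proof (rule less.hyps[of v])
        show "card (?R v) < card (?R u)" by (rule lt)
      next
        fix x y z assume xyz: "x \<in> X" "y \<in> X" "z \<in> X"
        show "v x z \<le> max (v x y) (v y z)"
          using less.prems(4)[OF xyz] by (auto simp: v_def max_def split: if_splits)
      qed (use less.prems t in \<open>auto simp: v_def\<close>)
      then show ?thesis using that by blast
    qed
    \<comment> \<open>\<open>c x\<close> represents the class of \<open>x\<close>; its unit vector takes the coordinate \<open>K + c x\<close>.\<close>
    define c where "c x = Min {z\<in>X. u x z = 0}" for x
    have c: "c x \<in> X" "u x (c x) = 0" if "x \<in> X" for x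
      using Min_in[of "{z\<in>X. u x z = 0}"] X that less.prems(2)[OF that] by (auto simp: c_def)
    have c_eq: "c x = c y \<longleftrightarrow> u x y = 0" if xy: "x \<in> X" "y \<in> X" for x y
    proof
      assume eq: "c x = c y"
      have "u x y \<le> max (u x (c x)) (u (c x) y)"
        using xy c by (intro less.prems(4)) auto
      also have "u (c x) y = u y (c y)"
        using xy c less.prems(3)[of "c x" y] eq by simp
      finally show "u x y = 0"
        using xy c less.prems(1)[OF xy] by simp
    next
      assume 0: "u x y = 0"
      have "u x z = 0 \<longleftrightarrow> u y z = 0" if z: "z \<in> X" for z
        using less.prems(4)[OF xy z] less.prems(4)[OF xy(2,1) z] less.prems(3)[OF xy] 0
          less.prems(1)[OF xy(1) z] less.prems(1)[OF xy(2) z] by auto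
      then show "c x = c y"
        unfolding c_def by (intro arg_cong[of _ _ Min]) auto
    qed
    obtain M where M: "\<And>x. x \<in> X \<Longrightarrow> x < M"
      using X finite_nat_set_iff_bounded by auto
    define h where "h x i = (if i < K then f x i else if i - K = c x then sqrt (t / 2) else 0)"
      for x i
    have "u x y = (\<Sum>i<K + M. (h x i - h y i)\<^sup>2)" if xy: "x \<in> X" "y \<in> X" for x y
    proof -
      have "(\<Sum>i<K + M. (h x i - h y i)\<^sup>2)
          = (\<Sum>i<K. (h x i - h y i)\<^sup>2) + (\<Sum>i<M. (h x (i + K) - h y (i + K))\<^sup>2)"
        using sum.atLeastLessThan_concat[of 0 K "K + M" "\<lambda>i. (h x i - h y i)\<^sup>2"]
          sum.shift_bounds_nat_ivl[of "\<lambda>i. (h x i - h y i)\<^sup>2" 0 K M]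
        by (simp add: atLeast0LessThan add.commute)
      also have "(\<Sum>i<K. (h x i - h y i)\<^sup>2) = v x y"
        using f[OF xy] by (simp add: h_def)
      also have "(\<Sum>i<M. (h x (i + K) - h y (i + K))\<^sup>2) = (if u x y = 0 then 0 else t)"
      proof (cases "u x y = 0")
        case True
        then show ?thesis using c_eq[OF xy] by (simp add: h_def)
      next
        case False
        then have ne: "c x \<noteq> c y" using c_eq[OF xy] by simp
        have "(\<Sum>i<M. (h x (i + K) - h y (i + K))\<^sup>2)
            = (\<Sum>i<M. (if i = c x then t / 2 else 0) + (if i = c y then t / 2 else 0))"
          using t ne by (intro sum.cong refl) (auto simp: h_def)
        also have "\<dots> = t"
          using M c xy by (simp add: sum.distrib)
        finally show ?thesis using False by simp
      qed
      also have "v x y + (if u x y = 0 then 0 else t) = u x y"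
        using tle[OF xy] t by (auto simp: v_def max_def)
      finally show ?thesis by simp
    qed
    then show ?thesis by blast
  qed
qed

lemma sqrt_finite_sum_l2:
  fixes x y :: "nat \<Rightarrow> real"
  assumes "\<And>i. i \<ge> K \<Longrightarrow> x i = 0" "\<And>i. i \<ge> K \<Longrightarrow> y i = 0"
  shows "x \<in> mspace l2" "mdist l2 x y = sqrt (\<Sum>i<K. (x i - y i)\<^sup>2)"
proof -
  have "(\<lambda>i. (x i)\<^sup>2) summable_on UNIV \<longleftrightarrow> (\<lambda>i. (x i)\<^sup>2) summable_on {..<K}"
    using assms by (intro summable_on_cong_neutral) auto
  then show "x \<in> mspace l2" by (simp add: mspace_l2)
  have "(\<Sum>\<^sub>\<infinity>i. (x i - y i)\<^sup>2) = (\<Sum>\<^sub>\<infinity>i\<in>{..<K}. (x i - y i)\<^sup>2)"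
    using assms by (intro infsum_cong_neutral) auto
  then show "mdist l2 x y = sqrt (\<Sum>i<K. (x i - y i)\<^sup>2)"
    by (simp add: mdist_l2)
qed

lemma finite_ultrametric_into_l2:
  assumes Y: "Y \<in> UM" and T: "finite T" "T \<subseteq> mspace Y"
  shows "\<exists>h. h ` T \<subseteq> mspace l2 \<and> (\<forall>x\<in>T. \<forall>y\<in>T. mdist l2 (h x) (h y) = mdist Y x y)"
proof -
  have "\<exists>K (f :: nat \<Rightarrow> nat \<Rightarrow> real). \<forall>x\<in>T. \<forall>y\<in>T. (mdist Y x y)\<^sup>2 = (\<Sum>i<K. (f x i - f y i)\<^sup>2)"
  proof (rule finite_ultrametric_into_Euclidean[OF T(1)])
    fix x y z assume "x \<in> T" "y \<in> T" "z \<in> T"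
    then have "mdist Y x z \<le> max (mdist Y x y) (mdist Y y z)"
      using Y T unfolding ultrametrics_def by blast
    then have "(mdist Y x z)\<^sup>2 \<le> (max (mdist Y x y) (mdist Y y z))\<^sup>2"
      by (intro power_mono) auto
    then show "(mdist Y x z)\<^sup>2 \<le> max ((mdist Y x y)\<^sup>2) ((mdist Y y z)\<^sup>2)"
      by (auto simp: max_def split: if_splits)
  qed (use T in \<open>auto simp: mdist_commute\<close>)
  then obtain K and f :: "nat \<Rightarrow> nat \<Rightarrow> real"
    where f: "\<And>x y. x \<in> T \<Longrightarrow> y \<in> T \<Longrightarrow> (mdist Y x y)\<^sup>2 = (\<Sum>i<K. (f x i - f y i)\<^sup>2)"
    by blast
  define h where "h x i = (if i < K then f x i else 0)" for x i
  have l2: "h x \<in> mspace l2" "mdist l2 (h x) (h y) = sqrt (\<Sum>i<K. (h x i - h y i)\<^sup>2)" for x y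
    using sqrt_finite_sum_l2[of K "h x" "h y"] by (simp_all add: h_def)
  have "mdist l2 (h x) (h y) = mdist Y x y" if "x \<in> T" "y \<in> T" for x y
    using f[OF that, symmetric] by (simp add: l2 h_def)
  then show ?thesis using l2 by (intro exI[of _ h]) auto
qed

lemma has_embedding_subspace_UM_imp_l2:
  assumes X: "finite (mspace X)" and e: "has_embedding_subspace UM \<alpha> m X"
  shows "has_embedding_subspace {l2} \<alpha> m X"
proof -
  obtain S Y where S: "S \<subseteq> mspace X" "card S = m" and Y: "Y \<in> UM"
    and le: "least_distortion Y (submetric X S) \<le> ennreal \<alpha>"
    using e by (auto simp: has_embedding_subspace_def embeds_class_def least_distortion_class_def)
  have "least_distortion l2 (submetric X S) \<le> least_distortion Y (submetric X S)"
    unfolding least_distortion_def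
  proof (rule INF_mono)
    fix f assume f: "f \<in> embeddings (submetric X S) Y"
    have Z: "mspace (submetric X S) = S" using S by auto
    have fS: "inj_on f S" "f ` S \<subseteq> mspace Y"
      using f unfolding embeddings_def Z by auto
    obtain h where h: "h ` f ` S \<subseteq> mspace l2"
      "\<And>x y. x \<in> S \<Longrightarrow> y \<in> S \<Longrightarrow> mdist l2 (h (f x)) (h (f y)) = mdist Y (f x) (f y)"
    proof -
      have "finite (f ` S)" "f ` S \<subseteq> mspace Y"
        using fS finite_subset[OF S(1) X] by auto
      then show ?thesis
        using finite_ultrametric_into_l2[OF Y] that by (metis imageI)
    qed
    have "inj_on (h \<circ> f) S"
    proof (rule inj_onI)
      fix x y assume xy: "x \<in> S" "y \<in> S" "(h \<circ> f) x = (h \<circ> f) y"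
      then have "mdist Y (f x) (f y) = 0"
      proof -
        have "mdist l2 (h (f x)) (h (f x)) = 0" using h(1) xy by (subst mdist_zero) auto
        then show ?thesis using h(2)[OF xy(1,2)] xy(3) by simp
      qed
      then have "f x = f y"
        using fS xy by (subst (asm) mdist_zero) auto
      then show "x = y" using fS xy by (auto dest: inj_onD)
    qed
    then have "h \<circ> f \<in> embeddings (submetric X S) l2"
      using h(1) unfolding embeddings_def Z by auto
    moreover have "expansion (submetric X S) l2 (h \<circ> f) = expansion (submetric X S) Y f"
      unfolding expansion_def Z using h(2) by (intro SUP_cong) auto
    moreover have "contraction (submetric X S) l2 (h \<circ> f) = contraction (submetric X S) Y f"
      unfolding contraction_def Z using h(2) by (intro SUP_cong) auto
    ultimately show "\<exists>k\<in>embeddings (submetric X S) l2.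
        distortion (submetric X S) l2 k \<le> distortion (submetric X S) Y f"
      by (intro bexI[of _ "h \<circ> f"]) (auto simp: distortion_def)
  qed
  then have "embeds_class \<alpha> (submetric X S) {l2}"
    using le by (auto simp: embeds_class_def least_distortion_class_def)
  then show ?thesis using S by (auto simp: has_embedding_subspace_def)
qed

section \<open>Fourier analysis on the subsets of a finite set\<close>

lemma minus_one_power_card_sym_diff:
  assumes "finite A" "finite B"
  shows "(- 1 :: real) ^ card (sym_diff A B) = (- 1) ^ card A * (- 1) ^ card B"
proof -
  have "card A = card (A - B) + card (A \<inter> B)" "card B = card (B - A) + card (A \<inter> B)"
    using assms by (metis card_Diff_subset_Int card_mono finite_Int inf_commute inf_le1 le_add_diff_inverse2)+
  moreover have "card (sym_diff A B) = card (A - B) + card (B - A)"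
    using assms by (intro card_Un_disjoint) auto
  ultimately show ?thesis by (simp add: power_add)
qed

text \<open>
  The characters of the group of finite sets under symmetric difference.
\<close>

definition walsh :: "'a set \<Rightarrow> 'a set \<Rightarrow> real" where
  "walsh a x = (- 1) ^ card (a \<inter> x)"

lemma walsh_commute: "walsh a x = walsh x a"
  by (simp add: walsh_def Int_commute)

lemma walsh_empty [simp]: "walsh {} x = 1" "walsh a {} = 1"
  by (simp_all add: walsh_def)

lemma walsh_sym_diff:
  assumes "finite x" "finite y"
  shows "walsh a (sym_diff x y) = walsh a x * walsh a y"
proof -
  have "a \<inter> sym_diff x y = sym_diff (a \<inter> x) (a \<inter> y)" by blast
  then show ?thesis
    unfolding walsh_def using assms by (simp add: minus_one_power_card_sym_diff)
qed

lemma walsh_cases: "walsh a x = 1 \<or> walsh a x = - 1"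
  unfolding walsh_def by (cases "even (card (a \<inter> x))") simp_all

lemma sum_Pow_translate:
  assumes "g \<subseteq> A"
  shows "(\<Sum>x\<in>Pow A. p (sym_diff x g)) = (\<Sum>x\<in>Pow A. p x)"
  by (rule sum.reindex_bij_witness[of _ "\<lambda>x. sym_diff x g" "\<lambda>x. sym_diff x g"])
    (use assms in \<open>auto simp: Un_Diff Diff_Un\<close>)

text \<open>
  Translation by a single element of \<open>a\<close> changes the sign of the character \<open>walsh a\<close>, but not its sum.
\<close>

lemma sum_walsh:
  assumes "finite A" "a \<subseteq> A"
  shows "(\<Sum>x\<in>Pow A. walsh a x) = (if a = {} then 2 ^ card A else 0)"
proof (cases "a = {}")
  case False
  then obtain e where e: "e \<in> a" by blast
  have "(\<Sum>x\<in>Pow A. walsh a x) = (\<Sum>x\<in>Pow A. walsh a (sym_diff x {e}))"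
    using e assms by (intro sum_Pow_translate[symmetric]) auto
  also have "\<dots> = (\<Sum>x\<in>Pow A. - walsh a x)"
  proof (rule sum.cong)
    fix x assume "x \<in> Pow A"
    then have "finite x" using assms finite_subset by auto
    then have "walsh a (sym_diff x {e}) = walsh a x * walsh a {e}"
      by (rule walsh_sym_diff) simp
    then show "walsh a (sym_diff x {e}) = - walsh a x"
      using e by (simp add: walsh_def)
  qed simp
  finally show ?thesis using False by (simp add: sum_negf)
qed (use assms in \<open>simp add: card_Pow\<close>)

lemma sum_walsh_frequencies:
  assumes "finite A" "x \<subseteq> A"
  shows "(\<Sum>a\<in>Pow A. walsh a x) = (if x = {} then 2 ^ card A else 0)"
  using sum_walsh[OF assms] by (simp add: walsh_commute)

definition walsh_transform :: "'a set \<Rightarrow> ('a set \<Rightarrow> real) \<Rightarrow> 'a set \<Rightarrow> real" where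
  "walsh_transform A f a = (\<Sum>x\<in>Pow A. walsh a x * f x)"

lemma parseval:
  assumes A: "finite A"
  shows "(\<Sum>a\<in>Pow A. (walsh_transform A f a)\<^sup>2) = 2 ^ card A * (\<Sum>x\<in>Pow A. (f x)\<^sup>2)"
proof -
  have eq: "walsh a x * walsh a y = walsh a (sym_diff x y)" if "x \<in> Pow A" "y \<in> Pow A" for a x y
    using that A by (intro walsh_sym_diff[symmetric]) (auto intro: finite_subset)
  have "(\<Sum>a\<in>Pow A. (walsh_transform A f a)\<^sup>2)
      = (\<Sum>a\<in>Pow A. \<Sum>x\<in>Pow A. \<Sum>y\<in>Pow A. walsh a (sym_diff x y) * (f x * f y))"
    unfolding walsh_transform_def power2_eq_square sum_product
    by (intro sum.cong refl) (simp flip: eq)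
  also have "\<dots> = (\<Sum>x\<in>Pow A. \<Sum>a\<in>Pow A. \<Sum>y\<in>Pow A. walsh a (sym_diff x y) * (f x * f y))"
    by (rule sum.swap)
  also have "\<dots> = (\<Sum>x\<in>Pow A. \<Sum>y\<in>Pow A. \<Sum>a\<in>Pow A. walsh a (sym_diff x y) * (f x * f y))"
    by (intro sum.cong refl sum.swap)
  also have "\<dots> = (\<Sum>x\<in>Pow A. \<Sum>y\<in>Pow A. if x = y then 2 ^ card A * (f x)\<^sup>2 else 0)"
  proof (intro sum.cong refl)
    fix x y assume xy: "x \<in> Pow A" "y \<in> Pow A"
    have "(\<Sum>a\<in>Pow A. walsh a (sym_diff x y) * (f x * f y))
        = (if sym_diff x y = {} then 2 ^ card A else 0) * (f x * f y)"
      unfolding sum_distrib_right[symmetric] using xy by (subst sum_walsh_frequencies[OF A]) auto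
    also have "sym_diff x y = {} \<longleftrightarrow> x = y" by blast
    finally show "(\<Sum>a\<in>Pow A. walsh a (sym_diff x y) * (f x * f y))
        = (if x = y then 2 ^ card A * (f x)\<^sup>2 else 0)"
      by (simp add: power2_eq_square)
  qed
  also have "\<dots> = 2 ^ card A * (\<Sum>x\<in>Pow A. (f x)\<^sup>2)"
    using A by (simp add: sum_distrib_left)
  finally show ?thesis .
qed

lemma walsh_transform_difference:
  assumes A: "finite A" and g: "g \<subseteq> A"
  shows "walsh_transform A (\<lambda>x. f (sym_diff x g) - f x) a = (walsh a g - 1) * walsh_transform A f a"
proof -
  have "(\<Sum>x\<in>Pow A. walsh a x * f (sym_diff x g))
      = (\<Sum>x\<in>Pow A. walsh a (sym_diff (sym_diff x g) g) * f (sym_diff x g))"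
    by (intro sum.cong refl arg_cong2[where f = "(*)"] arg_cong2[where f = walsh]) blast
  also have "\<dots> = (\<Sum>x\<in>Pow A. walsh a (sym_diff x g) * f x)"
    using g by (rule sum_Pow_translate[where p = "\<lambda>x. walsh a (sym_diff x g) * f x"])
  also have "\<dots> = (\<Sum>x\<in>Pow A. walsh a g * (walsh a x * f x))"
  proof (intro sum.cong refl)
    fix x assume "x \<in> Pow A"
    then have "finite x" "finite g" using A g finite_subset by auto
    then show "walsh a (sym_diff x g) * f x = walsh a g * (walsh a x * f x)"
      by (simp add: walsh_sym_diff)
  qed
  finally show ?thesis
    by (simp add: walsh_transform_def algebra_simps sum_subtractf sum_distrib_left)
qed

text \<open>
  In the Fourier basis both sides are diagonal. A pair of independent points weighs every nontrivial
  frequency equally, while translation by \<open>g i\<close> weighs the frequency \<open>a\<close> by \<open>(walsh a (g i) - 1)\<^sup>2\<close>,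
  which is 4 or 0. The spectral gap \<open>k\<close> says that each nontrivial frequency meets the weight 4 for at
  least \<open>k\<close> of the generators.
\<close>

lemma poincare_Pow:
  fixes f :: "'a set \<Rightarrow> real" and g :: "'i \<Rightarrow> 'a set"
  assumes A: "finite A" and I: "finite I" and g: "\<And>i. i \<in> I \<Longrightarrow> g i \<subseteq> A"
    and gap: "\<And>a. a \<subseteq> A \<Longrightarrow> a \<noteq> {} \<Longrightarrow> k \<le> card {i\<in>I. walsh a (g i) = - 1}"
  shows "2 * real k * (\<Sum>x\<in>Pow A. \<Sum>y\<in>Pow A. (f x - f y)\<^sup>2)
       \<le> 2 ^ card A * (\<Sum>i\<in>I. \<Sum>x\<in>Pow A. (f (sym_diff x (g i)) - f x)\<^sup>2)"
proof -
  let ?N = "2 ^ card A :: real" and ?F = "walsh_transform A f"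
  have edge: "?N * (\<Sum>x\<in>Pow A. (f (sym_diff x (g i)) - f x)\<^sup>2)
      = (\<Sum>a\<in>Pow A. if walsh a (g i) = - 1 then 4 * (?F a)\<^sup>2 else 0)" if "i \<in> I" for i
  proof -
    have "?N * (\<Sum>x\<in>Pow A. (f (sym_diff x (g i)) - f x)\<^sup>2)
        = (\<Sum>a\<in>Pow A. ((walsh a (g i) - 1) * ?F a)\<^sup>2)"
      by (simp add: parseval[OF A, symmetric] walsh_transform_difference[OF A g[OF that], of f])
    also have "\<dots> = (\<Sum>a\<in>Pow A. if walsh a (g i) = - 1 then 4 * (?F a)\<^sup>2 else 0)"
    proof (intro sum.cong refl)
      fix a
      show "((walsh a (g i) - 1) * ?F a)\<^sup>2 = (if walsh a (g i) = - 1 then 4 * (?F a)\<^sup>2 else 0)"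
        using walsh_cases[of a "g i"] by (elim disjE) (simp_all add: power2_eq_square)
    qed
    finally show ?thesis .
  qed
  have pairs: "(\<Sum>x\<in>Pow A. \<Sum>y\<in>Pow A. (f x - f y)\<^sup>2) = 2 * (\<Sum>a\<in>Pow A - {{}}. (?F a)\<^sup>2)"
  proof -
    have "(\<Sum>x\<in>Pow A. \<Sum>y\<in>Pow A. (f x - f y)\<^sup>2)
        = (\<Sum>x\<in>Pow A. \<Sum>y\<in>Pow A. (f x)\<^sup>2 + (f y)\<^sup>2 - 2 * (f x * f y))"
      by (intro sum.cong refl) (simp add: power2_eq_square algebra_simps)
    also have "\<dots> = 2 * ?N * (\<Sum>x\<in>Pow A. (f x)\<^sup>2) - 2 * ((\<Sum>x\<in>Pow A. f x) * (\<Sum>x\<in>Pow A. f x))"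
      unfolding sum_product
      using A by (simp add: sum.distrib sum_subtractf sum_distrib_left card_Pow mult.assoc)
    also have "\<dots> = 2 * (\<Sum>a\<in>Pow A. (?F a)\<^sup>2) - 2 * (?F {})\<^sup>2"
      unfolding parseval[OF A] by (simp add: walsh_transform_def power2_eq_square)
    also have "\<dots> = 2 * (\<Sum>a\<in>Pow A - {{}}. (?F a)\<^sup>2)"
      using A by (simp add: sum_diff1)
    finally show ?thesis .
  qed
  have "2 * real k * (\<Sum>x\<in>Pow A. \<Sum>y\<in>Pow A. (f x - f y)\<^sup>2)
      = (\<Sum>a\<in>Pow A - {{}}. real k * (4 * (?F a)\<^sup>2))"
    by (simp add: pairs sum_distrib_left mult_ac)
  also have "\<dots> \<le> (\<Sum>a\<in>Pow A - {{}}. real (card {i\<in>I. walsh a (g i) = - 1}) * (4 * (?F a)\<^sup>2))"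
    using gap by (intro sum_mono mult_right_mono) auto
  also have "\<dots> \<le> (\<Sum>a\<in>Pow A. real (card {i\<in>I. walsh a (g i) = - 1}) * (4 * (?F a)\<^sup>2))"
    using A by (intro sum_mono2) auto
  also have "\<dots> = (\<Sum>a\<in>Pow A. \<Sum>i\<in>I. if walsh a (g i) = - 1 then 4 * (?F a)\<^sup>2 else 0)"
    using I by (simp flip: sum.inter_filter)
  also have "\<dots> = (\<Sum>i\<in>I. ?N * (\<Sum>x\<in>Pow A. (f (sym_diff x (g i)) - f x)\<^sup>2))"
    by (subst sum.swap) (simp add: edge)
  finally show ?thesis by (simp add: sum_distrib_left)
qed

text \<open>
  The Chernoff bound together with a union bound over the characters, by counting. For a fixed nonempty
  \<open>a\<close> and a uniformly chosen \<open>v\<close>, \<open>walsh a v\<close> is \<open>-1\<close> with probability 1/2, so the mean of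
  \<open>t a v\<close>, which is 1/4 or 1 accordingly, is 5/8. If a family of generators fails, then for some
  \<open>a\<close> its product of these weights exceeds \<open>(1 / 4) ^ k\<close>; by \<open>small\<close> the means of the
  products, summed over \<open>a\<close>, are too small for this to happen for every family.
\<close>

lemma exists_generators:
  fixes A :: "'a set" and I :: "'i set"
  assumes A: "finite A" and I: "finite I"
    and small: "2 ^ card A * (5 / 8 :: real) ^ card I \<le> (1 / 4) ^ k"
  shows "\<exists>g. (\<forall>i\<in>I. g i \<subseteq> A) \<and> (\<forall>a\<subseteq>A. a \<noteq> {} \<longrightarrow> k \<le> card {i\<in>I. walsh a (g i) = - 1})"
proof (rule ccontr)
  assume none: "\<not> ?thesis"
  have bad: "\<exists>a\<in>Pow A - {{}}. card {i\<in>I. walsh a (g i) = - 1} < k"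
    if "g \<in> PiE I (\<lambda>_. Pow A)" for g
  proof -
    have "\<forall>i\<in>I. g i \<subseteq> A" using that by (auto simp: PiE_iff)
    then show ?thesis
      using none by (metis DiffI PowI not_le singletonD)
  qed
  let ?N = "2 ^ card A :: real"
  define t :: "'a set \<Rightarrow> 'a set \<Rightarrow> real" where "t a v = (if walsh a v = - 1 then 1 / 4 else 1)" for a v
  have t: "(\<Sum>v\<in>Pow A. t a v) = ?N * (5 / 8)" if "a \<in> Pow A - {{}}" for a
  proof -
    have "t a v = 5 / 8 + 3 / 8 * walsh a v" for v
      using walsh_cases[of a v] by (elim disjE) (simp_all add: t_def)
    then have "(\<Sum>v\<in>Pow A. t a v) = (\<Sum>v\<in>Pow A. 5 / 8) + 3 / 8 * (\<Sum>v\<in>Pow A. walsh a v)"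
      by (simp add: sum.distrib sum_distrib_left)
    then show ?thesis
      using that A sum_walsh[of A a] by (simp add: card_Pow)
  qed
  have pt: "(\<Prod>i\<in>I. t a (g i)) = (1 / 4) ^ card {i\<in>I. walsh a (g i) = - 1}" for a g
    using I by (simp add: t_def prod.If_cases Int_def)
  have "?N ^ card I * (1 / 4) ^ k = (\<Sum>g\<in>PiE I (\<lambda>_. Pow A). (1 / 4) ^ k)"
    using I A by (simp add: card_PiE card_Pow)
  also have "\<dots> \<le> (\<Sum>g\<in>PiE I (\<lambda>_. Pow A). \<Sum>a\<in>Pow A - {{}}. \<Prod>i\<in>I. t a (g i))"
  proof (rule sum_mono)
    fix g assume "g \<in> PiE I (\<lambda>_. Pow A)"
    then obtain a where a: "a \<in> Pow A - {{}}" "card {i\<in>I. walsh a (g i) = - 1} < k"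
      using bad by blast
    have "(1 / 4 :: real) ^ k \<le> (\<Prod>i\<in>I. t a (g i))"
      unfolding pt using a by (intro power_decreasing) auto
    also have "\<dots> \<le> (\<Sum>a\<in>Pow A - {{}}. \<Prod>i\<in>I. t a (g i))"
      using a A by (intro member_le_sum) (auto simp: pt)
    finally show "(1 / 4) ^ k \<le> (\<Sum>a\<in>Pow A - {{}}. \<Prod>i\<in>I. t a (g i))" .
  qed
  also have "\<dots> = (\<Sum>a\<in>Pow A - {{}}. \<Sum>g\<in>PiE I (\<lambda>_. Pow A). \<Prod>i\<in>I. t a (g i))"
    by (rule sum.swap)
  also have "\<dots> = (\<Sum>a\<in>Pow A - {{}}. \<Prod>i\<in>I. \<Sum>v\<in>Pow A. t a v)"
    using I A by (intro sum.cong refl prod_sum_PiE[symmetric]) auto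
  also have "\<dots> = (\<Sum>a\<in>Pow A - {{}}. (?N * (5 / 8)) ^ card I)"
    by (intro sum.cong refl) (simp add: t)
  also have "\<dots> = (?N - 1) * (?N * (5 / 8)) ^ card I"
    using A by (simp add: card_Diff_subset card_Pow of_nat_diff)
  also have "\<dots> < ?N * (?N * (5 / 8)) ^ card I"
    by simp
  also have "\<dots> = ?N ^ card I * (?N * (5 / 8) ^ card I)"
    by (simp only: power_mult_distrib mult_ac)
  also have "\<dots> \<le> ?N ^ card I * (1 / 4) ^ k"
    using small by (intro mult_left_mono) auto
  finally show False by simp
qed

section \<open>Large subsets of an expander\<close>

text \<open>
  The slack between \<open>\<alpha>\<close> and \<open>\<gamma>\<close> is there because the least distortion is an infimum that need not be
  attained.
\<close>

lemma bilipschitz_of_embeds_class: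
  assumes e: "embeds_class \<alpha> X {Y}" and ne: "x0 \<in> mspace X" "y0 \<in> mspace X" "x0 \<noteq> y0"
    and \<alpha>: "\<alpha> < \<gamma>" "0 < \<gamma>"
  shows "\<exists>f A B. f ` mspace X \<subseteq> mspace Y \<and> 0 \<le> A \<and> 0 \<le> B \<and> A * B < \<gamma> \<and>
     (\<forall>x\<in>mspace X. \<forall>y\<in>mspace X. mdist Y (f x) (f y) \<le> B * mdist X x y \<and>
        mdist X x y \<le> A * mdist Y (f x) (f y))"
proof -
  have "least_distortion Y X \<le> ennreal \<alpha>"
    using e by (simp add: embeds_class_def least_distortion_class_def)
  also have "\<dots> < ennreal \<gamma>"
    using \<alpha> by (simp add: ennreal_lessI)
  finally obtain f where f: "f \<in> embeddings X Y" and "distortion X Y f < ennreal \<gamma>"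
    unfolding least_distortion_def INF_less_iff by blast
  then have lt: "expansion X Y f * contraction X Y f < ennreal \<gamma>"
    using ne by (auto simp: distortion_def split: if_splits)
  have pos: "0 < mdist X x y" "0 < mdist Y (f x) (f y)"
    if "x \<in> mspace X" "y \<in> mspace X" "x \<noteq> y" for x y
  proof -
    have "f x \<noteq> f y" "f x \<in> mspace Y" "f y \<in> mspace Y"
      using f that by (auto simp: embeddings_def dest: inj_onD)
    then show "0 < mdist X x y" "0 < mdist Y (f x) (f y)"
      using that mdist_nonneg[of X x y] mdist_nonneg[of Y "f x" "f y"] by (auto simp: less_le)
  qed
  have E: "ennreal (mdist Y (f x) (f y) / mdist X x y) \<le> expansion X Y f"
    and C: "ennreal (mdist X x y / mdist Y (f x) (f y)) \<le> contraction X Y f"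
    if "x \<in> mspace X" "y \<in> mspace X" "x \<noteq> y" for x y
    unfolding expansion_def contraction_def using that
    by (auto intro!: SUP_upper2[of "(x, y)"])
  have "0 < expansion X Y f" "0 < contraction X Y f"
    using less_le_trans[OF _ E[OF ne]] less_le_trans[OF _ C[OF ne]] pos[OF ne] by auto
  with lt have fin: "expansion X Y f < top" "contraction X Y f < top"
    by (auto simp: ennreal_mult_eq_top_iff less_top[symmetric])
  define B where "B = enn2real (expansion X Y f)"
  define A where "A = enn2real (contraction X Y f)"
  have AB: "expansion X Y f = ennreal B" "contraction X Y f = ennreal A" "0 \<le> A" "0 \<le> B"
    using fin by (auto simp: A_def B_def)
  have "A * B < \<gamma>"
    using lt AB \<alpha> by (simp add: ennreal_mult[symmetric] ennreal_less_iff mult.commute)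
  moreover have "mdist Y (f x) (f y) \<le> B * mdist X x y \<and> mdist X x y \<le> A * mdist Y (f x) (f y)"
    if xy: "x \<in> mspace X" "y \<in> mspace X" for x y
  proof (cases "x = y")
    case True
    moreover have "f x \<in> mspace Y" using f xy by (auto simp: embeddings_def)
    then have "mdist Y (f x) (f x) = 0" "mdist X x x = 0" using xy by simp_all
    ultimately show ?thesis by simp
  next
    case False
    then show ?thesis
      using E[OF xy False] C[OF xy False] pos[OF xy False] AB
      by (simp add: divide_le_eq)
  qed
  ultimately show ?thesis
    using f AB by (intro exI[of _ f] exI[of _ A] exI[of _ B]) (auto simp: embeddings_def)
qed

lemma has_sum_finite_sum:
  fixes f :: "'i \<Rightarrow> 'a \<Rightarrow> real"
  assumes "finite I" "\<And>i. i \<in> I \<Longrightarrow> ((\<lambda>j. f i j) has_sum s i) X"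
  shows "((\<lambda>j. \<Sum>i\<in>I. f i j) has_sum (\<Sum>i\<in>I. s i)) X"
  using assms by (induction I) (auto intro: has_sum_add)

text \<open>
  A quadratic inequality for real functions holds for Hilbert-valued ones by summing it over the
  coordinates.
\<close>

lemma poincare_l2:
  fixes F :: "'v \<Rightarrow> nat \<Rightarrow> real" and \<tau> :: "'i \<Rightarrow> 'v \<Rightarrow> 'v"
  assumes V: "finite V" and I: "finite I" and \<tau>: "\<And>i x. i \<in> I \<Longrightarrow> x \<in> V \<Longrightarrow> \<tau> i x \<in> V"
    and poincare: "\<And>\<phi> :: 'v \<Rightarrow> real. a * (\<Sum>x\<in>V. \<Sum>y\<in>V. (\<phi> x - \<phi> y)\<^sup>2)
                     \<le> b * (\<Sum>i\<in>I. \<Sum>x\<in>V. (\<phi> (\<tau> i x) - \<phi> x)\<^sup>2)"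
    and F: "\<And>x. x \<in> V \<Longrightarrow> F x \<in> mspace l2"
  shows "a * (\<Sum>x\<in>V. \<Sum>y\<in>V. (mdist l2 (F x) (F y))\<^sup>2)
       \<le> b * (\<Sum>i\<in>I. \<Sum>x\<in>V. (mdist l2 (F (\<tau> i x)) (F x))\<^sup>2)"
proof -
  have sq: "((\<lambda>j. (F x j - F y j)\<^sup>2) has_sum (mdist l2 (F x) (F y))\<^sup>2) UNIV"
    if "x \<in> V" "y \<in> V" for x y
  proof -
    have "(\<lambda>j. (F x j - F y j)\<^sup>2) summable_on UNIV"
      using F[OF that(1)] F[OF that(2)] by (simp add: mspace_l2 l2_summable_diff)
    then show ?thesis
      by (simp add: mdist_l2 infsum_nonneg)
  qed
  show ?thesis
  proof (rule has_sum_mono)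
    show "((\<lambda>j. a * (\<Sum>x\<in>V. \<Sum>y\<in>V. (F x j - F y j)\<^sup>2))
        has_sum a * (\<Sum>x\<in>V. \<Sum>y\<in>V. (mdist l2 (F x) (F y))\<^sup>2)) UNIV"
      using V by (intro has_sum_cmult_right has_sum_finite_sum sq)
    show "((\<lambda>j. b * (\<Sum>i\<in>I. \<Sum>x\<in>V. (F (\<tau> i x) j - F x j)\<^sup>2))
        has_sum b * (\<Sum>i\<in>I. \<Sum>x\<in>V. (mdist l2 (F (\<tau> i x)) (F x))\<^sup>2)) UNIV"
      using V I \<tau> by (intro has_sum_cmult_right has_sum_finite_sum sq) auto
    show "a * (\<Sum>x\<in>V. \<Sum>y\<in>V. (F x j - F y j)\<^sup>2)
        \<le> b * (\<Sum>i\<in>I. \<Sum>x\<in>V. (F (\<tau> i x) j - F x j)\<^sup>2)" for j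
      by (rule poincare)
  qed
qed

text \<open>
  The distortion of a map is at most \<open>A * B\<close> when it has the Lipschitz constant \<open>B\<close> and its inverse
  has the Lipschitz constant \<open>A\<close>. The proportion 3/4 exceeds the proportion of points in a ball by
  enough for a large subset to contain many distant pairs.
\<close>

definition l2_resistant :: "'v set \<Rightarrow> ('v \<Rightarrow> 'v \<Rightarrow> real) \<Rightarrow> real \<Rightarrow> bool" where
  "l2_resistant V \<rho> D \<longleftrightarrow>
     (\<forall>S F A B. S \<subseteq> V \<and> 3 * card V < 4 * card S \<and> F ` S \<subseteq> mspace l2 \<and> 0 \<le> A \<and> 0 \<le> B \<and>
        (\<forall>x\<in>S. \<forall>y\<in>S. mdist l2 (F x) (F y) \<le> B * \<rho> x y \<and> \<rho> x y \<le> A * mdist l2 (F x) (F y))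
        \<longrightarrow> D \<le> A * B)"

lemma l2_resistantI:
  assumes "\<And>S (F :: 'v \<Rightarrow> nat \<Rightarrow> real) (A :: real) (B :: real).
      \<lbrakk>S \<subseteq> V; 3 * card V < 4 * card S; \<And>x. x \<in> S \<Longrightarrow> F x \<in> mspace l2; 0 \<le> A; 0 \<le> B;
       \<And>x y. x \<in> S \<Longrightarrow> y \<in> S \<Longrightarrow> mdist l2 (F x) (F y) \<le> B * \<rho> x y;
       \<And>x y. x \<in> S \<Longrightarrow> y \<in> S \<Longrightarrow> \<rho> x y \<le> A * mdist l2 (F x) (F y)\<rbrakk> \<Longrightarrow> D \<le> A * B"
  shows "l2_resistant V \<rho> D"
  unfolding l2_resistant_def by (intro allI impI) (elim conjE, rule assms, auto)

lemma l2_resistantD: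
  assumes "l2_resistant V \<rho> D" "S \<subseteq> V" "3 * card V < 4 * card S"
    and "\<And>x. x \<in> S \<Longrightarrow> F x \<in> mspace l2" "0 \<le> A" "0 \<le> B"
    and "\<And>x y. x \<in> S \<Longrightarrow> y \<in> S \<Longrightarrow> mdist l2 (F x) (F y) \<le> B * \<rho> x y"
    and "\<And>x y. x \<in> S \<Longrightarrow> y \<in> S \<Longrightarrow> \<rho> x y \<le> A * mdist l2 (F x) (F y)"
  shows "D \<le> A * B"
  using assms(1)[unfolded l2_resistant_def, rule_format, of S F A B] assms(2-) by blast

text \<open>
  The permutations \<open>\<tau> i\<close> move along the edges of a graph, and \<open>s\<close> is a radius for which every ball
  has at most a quarter of the points. Given \<open>F\<close> on \<open>S\<close>, let \<open>p\<close> be a nearest-point map onto \<open>S\<close> and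
  \<open>g x\<close> the distance from \<open>x\<close> to \<open>S\<close>. The Poincare inequality is used twice: for \<open>g\<close>, to
  see that the mean square of \<open>g\<close> is bounded, and then for \<open>F \<circ> p\<close>, which stretches an edge
  \<open>x, y\<close> by at most \<open>B * (1 + g x + g y)\<close>. So the mean square of \<open>F \<circ> p\<close> over all pairs
  is of the order of \<open>B\<^sup>2\<close>. It is also at least of the order of \<open>(s / A)\<^sup>2\<close>, since
  \<open>F \<circ> p\<close> is \<open>F\<close> on \<open>S\<close> and a constant proportion of the pairs in \<open>S\<close> are at
  distance more than \<open>s\<close>.
\<close>

lemma l2_resistant_if_poincare:
  fixes \<rho> :: "'v \<Rightarrow> 'v \<Rightarrow> real" and \<tau> :: "'i \<Rightarrow> 'v \<Rightarrow> 'v"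
  assumes V: "finite V" and I: "finite I" "I \<noteq> {}"
    and \<rho>_nonneg: "\<And>x y. x \<in> V \<Longrightarrow> y \<in> V \<Longrightarrow> 0 \<le> \<rho> x y"
    and \<rho>_zero: "\<And>x y. x \<in> V \<Longrightarrow> y \<in> V \<Longrightarrow> \<rho> x y = 0 \<longleftrightarrow> x = y"
    and \<rho>_sym: "\<And>x y. x \<in> V \<Longrightarrow> y \<in> V \<Longrightarrow> \<rho> x y = \<rho> y x"
    and \<rho>_triangle: "\<And>x y z. x \<in> V \<Longrightarrow> y \<in> V \<Longrightarrow> z \<in> V \<Longrightarrow> \<rho> x z \<le> \<rho> x y + \<rho> y z"
    and \<tau>: "\<And>i. i \<in> I \<Longrightarrow> bij_betw (\<tau> i) V V"
    and edge: "\<And>i x. i \<in> I \<Longrightarrow> x \<in> V \<Longrightarrow> \<rho> x (\<tau> i x) \<le> 1"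
    and poincare: "\<And>\<phi> :: 'v \<Rightarrow> real. card I * (\<Sum>x\<in>V. \<Sum>y\<in>V. (\<phi> x - \<phi> y)\<^sup>2)
                     \<le> 4 * card V * (\<Sum>i\<in>I. \<Sum>x\<in>V. (\<phi> (\<tau> i x) - \<phi> x)\<^sup>2)"
    and far: "\<And>x. x \<in> V \<Longrightarrow> 4 * card {y\<in>V. \<rho> x y \<le> s} \<le> card V" and s: "0 \<le> s"
  shows "l2_resistant V \<rho> (s / 20)"
proof (rule l2_resistantI)
  fix S :: "'v set" and F :: "'v \<Rightarrow> nat \<Rightarrow> real" and A B :: real
  assume S: "S \<subseteq> V" "3 * card V < 4 * card S"
    and F: "\<And>x. x \<in> S \<Longrightarrow> F x \<in> mspace l2"
    and AB: "0 \<le> A" "0 \<le> B"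
    and upper: "\<And>x y. x \<in> S \<Longrightarrow> y \<in> S \<Longrightarrow> mdist l2 (F x) (F y) \<le> B * \<rho> x y"
    and lower: "\<And>x y. x \<in> S \<Longrightarrow> y \<in> S \<Longrightarrow> \<rho> x y \<le> A * mdist l2 (F x) (F y)"
  define N where "N = real (card V)"
  define n where "n = real (card S)"
  define d where "d = real (card I)"
  have finS: "finite S" using S V finite_subset by blast
  have "S \<noteq> {}" using S(2) by auto
  then have "0 < N" using S(1) V by (auto simp: N_def card_gt_0_iff)
  have nN: "3 * N \<le> 4 * n" using S(2) by (simp add: N_def n_def)
  have "0 < d" using I by (simp add: d_def card_gt_0_iff)
  have \<tau>V: "\<tau> i x \<in> V" if "i \<in> I" "x \<in> V" for i x
    using \<tau>[OF that(1)] that(2) by (auto simp: bij_betw_def)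
  have "\<exists>p. p \<in> S \<and> (\<forall>y\<in>S. \<rho> x p \<le> \<rho> x y)" for x
    using finite_has_minimal[of "\<rho> x ` S"] finS \<open>S \<noteq> {}\<close>
    by (metis arg_min_if_finite(1) arg_min_least)
  then obtain p where p: "\<And>x. p x \<in> S" "\<And>x y. y \<in> S \<Longrightarrow> \<rho> x (p x) \<le> \<rho> x y"
    by metis
  have pV: "p x \<in> V" for x using p(1) S(1) by blast
  have pS: "p x = x" if "x \<in> S" for x
    using p(2)[OF that, of x] \<rho>_nonneg[of x "p x"] \<rho>_zero[of x x] \<rho>_zero[of x "p x"] that S(1) pV
    by force
  define g where "g x = \<rho> x (p x)" for x
  have g_edge: "(g (\<tau> i x) - g x)\<^sup>2 \<le> 1" if "i \<in> I" "x \<in> V" for i x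
  proof -
    have "g (\<tau> i x) \<le> \<rho> (\<tau> i x) (p x)" unfolding g_def using p by blast
    also have "\<dots> \<le> \<rho> (\<tau> i x) x + \<rho> x (p x)" using that \<tau>V pV by (intro \<rho>_triangle)
    finally have 1: "g (\<tau> i x) \<le> 1 + g x"
      using edge[OF that] \<rho>_sym[of x "\<tau> i x"] that \<tau>V by (simp add: g_def)
    have "g x \<le> \<rho> x (p (\<tau> i x))" unfolding g_def using p by blast
    also have "\<dots> \<le> \<rho> x (\<tau> i x) + \<rho> (\<tau> i x) (p (\<tau> i x))" using that \<tau>V pV by (intro \<rho>_triangle)
    finally have 2: "g x \<le> 1 + g (\<tau> i x)"
      using edge[OF that] by (simp add: g_def)
    show ?thesis using 1 2 by (simp add: abs_square_le_1)
  qed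
  define G where "G = (\<Sum>x\<in>V. (g x)\<^sup>2)"
  have G: "3 * G \<le> 16 * N"
  proof -
    have "d * (n * G) = d * (\<Sum>x\<in>S. \<Sum>y\<in>V. (g x - g y)\<^sup>2)"
    proof -
      have "g x = 0" if "x \<in> S" for x
        using that S(1) \<rho>_zero[of x x] by (auto simp: g_def pS)
      then show ?thesis by (simp add: n_def G_def)
    qed
    also have "\<dots> \<le> d * (\<Sum>x\<in>V. \<Sum>y\<in>V. (g x - g y)\<^sup>2)"
      using V S(1) \<open>0 < d\<close> by (intro mult_left_mono sum_mono2 sum_nonneg) auto
    also have "\<dots> \<le> 4 * N * (\<Sum>i\<in>I. \<Sum>x\<in>V. (g (\<tau> i x) - g x)\<^sup>2)"
      using poincare[of g] by (simp add: d_def N_def)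
    also have "\<dots> \<le> 4 * N * (\<Sum>i\<in>I. \<Sum>x\<in>V. 1)"
      using g_edge \<open>0 < N\<close> by (intro mult_left_mono sum_mono) auto
    also have "\<dots> = d * (4 * N * N)" by (simp add: d_def N_def)
    finally have "n * G \<le> 4 * N * N" using \<open>0 < d\<close> by simp
    moreover have "3 * N * G \<le> 4 * n * G"
      using nN by (intro mult_right_mono) (auto simp: G_def sum_nonneg)
    ultimately have "N * (3 * G) \<le> N * (16 * N)" by (simp add: mult_ac)
    then show ?thesis using \<open>0 < N\<close> by simp
  qed
  define E where "E x y = mdist l2 (F (p x)) (F (p y))" for x y
  have E_edge: "(E (\<tau> i x) x)\<^sup>2 \<le> 3 * B\<^sup>2 * (1 + (g x)\<^sup>2 + (g (\<tau> i x))\<^sup>2)"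
    if "i \<in> I" "x \<in> V" for i x
  proof -
    let ?y = "\<tau> i x"
    have y: "?y \<in> V" using \<tau>V that by blast
    have "\<rho> (p ?y) (p x) \<le> \<rho> (p ?y) ?y + \<rho> ?y (p x)" using that y pV by (intro \<rho>_triangle)
    also have "\<rho> ?y (p x) \<le> \<rho> ?y x + \<rho> x (p x)" using that y pV by (intro \<rho>_triangle)
    finally have "\<rho> (p ?y) (p x) \<le> 1 + g x + g ?y"
      using edge[OF that] \<rho>_sym[of "p ?y" ?y] \<rho>_sym[of x ?y] y pV that by (simp add: g_def)
    then have "B * \<rho> (p ?y) (p x) \<le> B * (1 + g x + g ?y)"
      using AB by (intro mult_left_mono) auto
    with upper[of "p ?y" "p x"] p have "E ?y x \<le> B * (1 + g x + g ?y)" unfolding E_def by force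
    then have "(E ?y x)\<^sup>2 \<le> (B * (1 + g x + g ?y))\<^sup>2"
      by (intro power_mono) (auto simp: E_def)
    also have "\<dots> = B\<^sup>2 * (1 + g x + g ?y)\<^sup>2" by (simp add: power_mult_distrib)
    also have "\<dots> \<le> B\<^sup>2 * (3 * (1 + (g x)\<^sup>2 + (g ?y)\<^sup>2))"
    proof (rule mult_left_mono)
      show "(1 + g x + g ?y)\<^sup>2 \<le> 3 * (1 + (g x)\<^sup>2 + (g ?y)\<^sup>2)"
        using zero_le_power2[of "1 - g x"] zero_le_power2[of "1 - g ?y"] zero_le_power2[of "g x - g ?y"]
        by (simp add: power2_eq_square algebra_simps)
    qed simp
    finally show ?thesis by (simp only: mult_ac)
  qed
  \<comment> \<open>Here 140 is the factor 4 of the Poincare inequality times \<open>35 = 3 * (1 + 2 * 16 / 3)\<close>, from \<open>E_edge\<close> and \<open>G\<close>.\<close>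
  have pairs: "(\<Sum>x\<in>V. \<Sum>y\<in>V. (E x y)\<^sup>2) \<le> 140 * B\<^sup>2 * N\<^sup>2"
  proof -
    have "d * (\<Sum>x\<in>V. \<Sum>y\<in>V. (E x y)\<^sup>2) \<le> 4 * N * (\<Sum>i\<in>I. \<Sum>x\<in>V. (E (\<tau> i x) x)\<^sup>2)"
      unfolding E_def d_def N_def
      using V I(1) \<tau>V poincare F p(1) by (intro poincare_l2) auto
    also have "\<dots> \<le> 4 * N * (\<Sum>i\<in>I. \<Sum>x\<in>V. 3 * B\<^sup>2 * (1 + (g x)\<^sup>2 + (g (\<tau> i x))\<^sup>2))"
      using E_edge \<open>0 < N\<close> by (intro mult_left_mono sum_mono) auto
    also have "(\<Sum>i\<in>I. \<Sum>x\<in>V. 3 * B\<^sup>2 * (1 + (g x)\<^sup>2 + (g (\<tau> i x))\<^sup>2)) = (\<Sum>i\<in>I. 3 * B\<^sup>2 * (N + 2 * G))"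
    proof (intro sum.cong refl)
      fix i assume "i \<in> I"
      then have "(\<Sum>x\<in>V. (g (\<tau> i x))\<^sup>2) = G"
        unfolding G_def using sum.reindex_bij_betw[OF \<tau>, of i "\<lambda>x. (g x)\<^sup>2"] by simp
      then show "(\<Sum>x\<in>V. 3 * B\<^sup>2 * (1 + (g x)\<^sup>2 + (g (\<tau> i x))\<^sup>2)) = 3 * B\<^sup>2 * (N + 2 * G)"
        by (simp add: sum_distrib_left[symmetric] sum.distrib N_def G_def)
    qed
    also have "\<dots> = d * (3 * B\<^sup>2 * (N + 2 * G))" by (simp add: d_def)
    finally have "d * (\<Sum>x\<in>V. \<Sum>y\<in>V. (E x y)\<^sup>2) \<le> d * (4 * N * (3 * B\<^sup>2 * (N + 2 * G)))"
      by (simp add: mult_ac)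
    then have "(\<Sum>x\<in>V. \<Sum>y\<in>V. (E x y)\<^sup>2) \<le> 4 * N * (B\<^sup>2 * (3 * N + 6 * G))"
      using \<open>0 < d\<close> by (simp only: mult_le_cancel_left_pos) (simp add: algebra_simps)
    also have "\<dots> \<le> 4 * N * (B\<^sup>2 * (35 * N))"
      using G \<open>0 < N\<close> by (intro mult_left_mono) auto
    finally show ?thesis by (simp add: power2_eq_square mult_ac)
  qed
  have low: "3 * N\<^sup>2 * s\<^sup>2 \<le> 8 * (A\<^sup>2 * (\<Sum>x\<in>V. \<Sum>y\<in>V. (E x y)\<^sup>2))"
  proof -
    \<comment> \<open>A point of \<open>S\<close> has at least \<open>n - N / 4\<close> points of \<open>S\<close> outside its ball of radius \<open>s\<close>.\<close>
    have row: "s\<^sup>2 * (n - N / 4) \<le> A\<^sup>2 * (\<Sum>y\<in>V. (E x y)\<^sup>2)" if x: "x \<in> S" for x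
    proof -
      let ?T = "{y\<in>S. s < \<rho> x y}"
      have "S \<subseteq> ?T \<union> {y\<in>V. \<rho> x y \<le> s}" using S(1) by auto
      then have "card S \<le> card (?T \<union> {y\<in>V. \<rho> x y \<le> s})"
        using V finS by (intro card_mono) auto
      also have "\<dots> \<le> card ?T + card {y\<in>V. \<rho> x y \<le> s}" by (rule card_Un_le)
      finally have "n - N / 4 \<le> card ?T"
        using far[of x] x S(1) unfolding n_def N_def by auto
      then have "s\<^sup>2 * (n - N / 4) \<le> (\<Sum>y\<in>?T. s\<^sup>2)"
        by (simp add: mult.commute mult_left_mono)
      also have "\<dots> \<le> (\<Sum>y\<in>?T. A\<^sup>2 * (E x y)\<^sup>2)"
      proof (rule sum_mono)
        fix y assume y: "y \<in> ?T"
        then have "s \<le> A * E x y"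
          using lower[OF x, of y] pS x by (simp add: E_def)
        then show "s\<^sup>2 \<le> A\<^sup>2 * (E x y)\<^sup>2"
          using s by (metis power_mono power_mult_distrib)
      qed
      also have "\<dots> \<le> (\<Sum>y\<in>V. A\<^sup>2 * (E x y)\<^sup>2)"
        using V S(1) by (intro sum_mono2) auto
      finally show ?thesis by (simp add: sum_distrib_left)
    qed
    have "3 * N\<^sup>2 \<le> 8 * (n * (n - N / 4))"
      using mult_mono[of "3 * N / 4" n "N / 2" "n - N / 4"] nN \<open>0 < N\<close>
      by (simp add: power2_eq_square)
    then have "3 * N\<^sup>2 * s\<^sup>2 \<le> 8 * (n * (n - N / 4)) * s\<^sup>2"
      by (rule mult_right_mono) simp
    also have "\<dots> = 8 * (\<Sum>x\<in>S. s\<^sup>2 * (n - N / 4))" by (simp add: n_def)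
    also have "\<dots> \<le> 8 * (\<Sum>x\<in>S. A\<^sup>2 * (\<Sum>y\<in>V. (E x y)\<^sup>2))"
      using row by (intro mult_left_mono sum_mono) auto
    also have "\<dots> \<le> 8 * (\<Sum>x\<in>V. A\<^sup>2 * (\<Sum>y\<in>V. (E x y)\<^sup>2))"
      using V S(1) by (intro mult_left_mono sum_mono2) (auto intro!: mult_nonneg_nonneg sum_nonneg)
    finally show ?thesis by (simp add: sum_distrib_left)
  qed
  have "N\<^sup>2 * (3 * s\<^sup>2) \<le> 8 * (A\<^sup>2 * (\<Sum>x\<in>V. \<Sum>y\<in>V. (E x y)\<^sup>2))"
    using low by (simp add: mult_ac)
  also have "\<dots> \<le> 8 * (A\<^sup>2 * (140 * B\<^sup>2 * N\<^sup>2))"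
    using pairs by (intro mult_left_mono) auto
  also have "\<dots> = N\<^sup>2 * (1120 * (A * B)\<^sup>2)"
    by (simp add: power_mult_distrib)
  finally have "3 * s\<^sup>2 \<le> 1120 * (A * B)\<^sup>2" using \<open>0 < N\<close> by simp
  also have "\<dots> \<le> 3 * (20 * (A * B))\<^sup>2" by (simp add: power_mult_distrib)
  finally have "s\<^sup>2 \<le> (20 * (A * B))\<^sup>2" by simp
  then have "s \<le> 20 * (A * B)" by (rule power2_le_imp_le) (use AB in auto)
  then show "s / 20 \<le> A * B" by simp
qed

section \<open>The Cayley metric of a random generating set\<close>

definition xor_sum :: "('i \<Rightarrow> 'a set) \<Rightarrow> 'i set \<Rightarrow> 'a set" where
  "xor_sum g J = {e. odd (card {j\<in>J. e \<in> g j})}"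

lemma xor_sum_sym_diff:
  assumes "finite J" "finite K"
  shows "xor_sum g (sym_diff J K) = sym_diff (xor_sum g J) (xor_sum g K)"
proof (rule set_eqI)
  fix e
  have "{j\<in>sym_diff J K. e \<in> g j} = sym_diff {j\<in>J. e \<in> g j} {j\<in>K. e \<in> g j}" by blast
  then have "(- 1 :: real) ^ card {j\<in>sym_diff J K. e \<in> g j}
      = (- 1) ^ card {j\<in>J. e \<in> g j} * (- 1) ^ card {j\<in>K. e \<in> g j}"
    using assms by (simp add: minus_one_power_card_sym_diff)
  then show "e \<in> xor_sum g (sym_diff J K) \<longleftrightarrow> e \<in> sym_diff (xor_sum g J) (xor_sum g K)"
    by (simp add: xor_sum_def minus_one_power_iff split: if_splits)
qed

lemma xor_sum_empty [simp]: "xor_sum g {} = {}"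
  by (simp add: xor_sum_def)

lemma xor_sum_singleton [simp]: "xor_sum g {i} = g i"
proof -
  have "{j\<in>{i}. e \<in> g j} = (if e \<in> g i then {i} else {})" for e by auto
  then show ?thesis by (simp add: xor_sum_def)
qed

text \<open>
  The length of a shortest word in the generators with value \<open>v\<close>. A word is a set of indices, since
  the group is commutative of exponent 2; counting sets instead of sequences makes balls small enough.
  Elements that the generators do not reach get the largest length, \<open>card I\<close>; the triangle
  inequality survives because no word is longer.
\<close>

definition word_norm :: "('i \<Rightarrow> 'a set) \<Rightarrow> 'i set \<Rightarrow> 'a set \<Rightarrow> nat" where
  "word_norm g I v = Min (insert (card I) (card ` {J. J \<subseteq> I \<and> xor_sum g J = v}))"

lemma word_norm_le_card:
  assumes "finite I"
  shows "word_norm g I v \<le> card I"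
  unfolding word_norm_def using assms by (intro Min_le) auto

lemma word_norm_le:
  assumes "finite I" "J \<subseteq> I"
  shows "word_norm g I (xor_sum g J) \<le> card J"
  unfolding word_norm_def using assms by (intro Min_le) auto

lemma word_norm_attained:
  assumes "finite I"
  obtains "word_norm g I v = card I" | J where "J \<subseteq> I" "xor_sum g J = v" "word_norm g I v = card J"
proof -
  have "word_norm g I v \<in> insert (card I) (card ` {J. J \<subseteq> I \<and> xor_sum g J = v})"
    unfolding word_norm_def using assms by (intro Min_in) auto
  then show ?thesis using that by blast
qed

lemma word_norm_sym_diff_le:
  assumes I: "finite I"
  shows "word_norm g I (sym_diff u v) \<le> word_norm g I u + word_norm g I v"
proof -
  note le = word_norm_le_card[OF I, of g "sym_diff u v"]
  consider "word_norm g I u = card I" | "word_norm g I v = card I"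
    | J K where "J \<subseteq> I" "xor_sum g J = u" "word_norm g I u = card J"
        "K \<subseteq> I" "xor_sum g K = v" "word_norm g I v = card K"
    by (metis word_norm_attained[OF I])
  then show ?thesis
  proof cases
    case 3
    then have fin: "finite J" "finite K" using I finite_subset by auto
    have "word_norm g I (sym_diff u v) \<le> card (sym_diff J K)"
      using word_norm_le[OF I, of "sym_diff J K" g] 3 by (auto simp: xor_sum_sym_diff[OF fin])
    also have "\<dots> \<le> card (J - K) + card (K - J)" by (rule card_Un_le)
    also have "\<dots> \<le> card J + card K" using fin by (intro add_mono card_mono) auto
    finally show ?thesis using 3 by simp
  qed (use le in auto)
qed

lemma word_norm_eq_0_iff:
  assumes "finite I" "I \<noteq> {}"
  shows "word_norm g I v = 0 \<longleftrightarrow> v = {}"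
proof
  assume 0: "word_norm g I v = 0"
  from word_norm_attained[OF assms(1), of g v] show "v = {}"
  proof cases
    case (2 J)
    then have "J = {}" using 0 assms finite_subset[of J I] by auto
    then show ?thesis using 2 by simp
  qed (use 0 assms in simp)
qed (use word_norm_le[OF assms(1), of "{}" g] in simp)

text \<open>
  Weighing every subset \<open>J\<close> by \<open>t ^ card J\<close> gives total weight \<open>(1 + t) ^ card I\<close>.
\<close>

lemma card_small_subsets:
  fixes t :: real
  assumes I: "finite I" and t: "0 \<le> t" "t \<le> 1"
  shows "card {J. J \<subseteq> I \<and> card J \<le> k} * t ^ k \<le> (1 + t) ^ card I"
proof -
  have "card {J. J \<subseteq> I \<and> card J \<le> k} * t ^ k = (\<Sum>J | J \<subseteq> I \<and> card J \<le> k. t ^ k)" by simp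
  also have "\<dots> \<le> (\<Sum>J | J \<subseteq> I \<and> card J \<le> k. t ^ card J)"
    using t by (intro sum_mono power_decreasing) auto
  also have "\<dots> \<le> (\<Sum>J\<in>Pow I. t ^ card J)"
    using I t by (intro sum_mono2) auto
  also have "\<dots> = (1 + t) ^ card I"
    using prod_add[OF I, of "\<lambda>_. t" "\<lambda>_. 1"] by (simp add: add.commute)
  finally show ?thesis .
qed

lemma card_word_ball:
  assumes I: "finite I" and k: "k < card I"
  shows "card {v. word_norm g I v \<le> k} \<le> card {J. J \<subseteq> I \<and> card J \<le> k}"
proof -
  have "{v. word_norm g I v \<le> k} \<subseteq> xor_sum g ` {J. J \<subseteq> I \<and> card J \<le> k}"
  proof
    fix v assume v: "v \<in> {v. word_norm g I v \<le> k}"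
    from word_norm_attained[OF I, of g v] show "v \<in> xor_sum g ` {J. J \<subseteq> I \<and> card J \<le> k}"
      using v k by cases auto
  qed
  then show ?thesis
    using I by (intro surj_card_le) auto
qed

text \<open>
  The numbers fit together as follows. The random generators have the gap \<open>8 * s\<close> because
  \<open>2 ^ 16 * (5 / 8) ^ 64 \<le> (1 / 4) ^ 8\<close>; being an eighth of \<open>64 * s\<close>, it gives the
  constant 4 in the Poincare inequality. With the weight \<open>t = 1 / 16\<close>, a ball of radius \<open>s\<close> has at most
  \<open>(16 * (17 / 16) ^ 64) ^ s\<close> points, which is below \<open>2 ^ (14 * s)\<close> and so below a quarter of
  \<open>2 ^ (16 * s)\<close>.
\<close>

lemma exists_l2_resistant_norm:
  fixes s :: nat
  assumes s: "1 \<le> s"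
  defines "V \<equiv> Pow {..<16 * s}"
  shows "\<exists>w :: nat set \<Rightarrow> nat. (\<forall>v. w v \<le> 64 * s) \<and> (\<forall>v. w v = 0 \<longleftrightarrow> v = {}) \<and>
     (\<forall>u v. w (sym_diff u v) \<le> w u + w v) \<and> l2_resistant V (\<lambda>x y. w (sym_diff x y)) (s / 20)"
proof -
  let ?A = "{..<16 * s}" and ?I = "{..<64 * s}"
  have I: "finite ?I" "?I \<noteq> {}" "card ?I = 64 * s" using s by (auto simp: lessThan_empty_iff)
  have cV: "card V = 2 ^ (16 * s)" by (simp add: V_def card_Pow)
  have "2 ^ card ?A * (5 / 8 :: real) ^ card ?I = (2 ^ 16 * (5 / 8) ^ 64) ^ s"
    by (simp only: card_lessThan power_mult power_mult_distrib)
  also have "\<dots> \<le> ((1 / 4) ^ 8) ^ s"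
    by (intro power_mono) (simp_all add: power_divide field_simps)
  finally have "2 ^ card ?A * (5 / 8 :: real) ^ card ?I \<le> (1 / 4) ^ (8 * s)"
    by (simp only: power_mult)
  then obtain g where g: "\<And>i. i \<in> ?I \<Longrightarrow> g i \<subseteq> ?A"
    and gap: "\<And>a. a \<subseteq> ?A \<Longrightarrow> a \<noteq> {} \<Longrightarrow> 8 * s \<le> card {i\<in>?I. walsh a (g i) = - 1}"
    using exists_generators[of ?A ?I "8 * s"] by blast
  define w where "w = word_norm g ?I"
  have w: "w v \<le> 64 * s" "w v = 0 \<longleftrightarrow> v = {}" "w (sym_diff u v) \<le> w u + w v" for u v
    unfolding w_def using word_norm_le_card[OF I(1), of g v] word_norm_eq_0_iff[OF I(1,2), of g v]
      word_norm_sym_diff_le[OF I(1), of g u v] I(3) by simp_all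
  have ball: "4 * card {v\<in>V. w v \<le> s} \<le> card V"
  proof -
    have "card {v\<in>V. w v \<le> s} \<le> card {v. w v \<le> s}"
    proof (rule card_mono)
      have "{v. w v \<le> s} \<subseteq> xor_sum g ` Pow ?I"
      proof
        fix v assume v: "v \<in> {v. w v \<le> s}"
        from word_norm_attained[OF I(1), of g v] show "v \<in> xor_sum g ` Pow ?I"
          using v s by cases (auto simp: w_def)
      qed
      then show "finite {v. w v \<le> s}" by (rule finite_subset) simp
    qed auto
    also have "\<dots> \<le> card {J. J \<subseteq> ?I \<and> card J \<le> s}"
      unfolding w_def using s I by (intro card_word_ball) auto
    finally have "card {v\<in>V. w v \<le> s} * (1 / 16 :: real) ^ s \<le> card {J. J \<subseteq> ?I \<and> card J \<le> s} * (1 / 16) ^ s"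
      by (intro mult_right_mono) auto
    also have "\<dots> \<le> (1 + 1 / 16) ^ (64 * s)"
      using card_small_subsets[OF I(1), of "1 / 16" s] I(3) by simp
    also have "\<dots> = ((17 / 16) ^ 64) ^ s" by (simp add: power_mult)
    also have "\<dots> \<le> 1024 ^ s" by (intro power_mono) (simp_all add: power_divide)
    finally have "card {v\<in>V. w v \<le> s} \<le> (16 * 1024 :: real) ^ s"
      by (simp add: power_divide field_simps flip: power_mult_distrib)
    then have "4 * real (card {v\<in>V. w v \<le> s}) \<le> 4 ^ s * (16 * 1024) ^ s"
      using s power_increasing[of 1 s "4 :: real"] by (intro mult_mono) auto
    also have "\<dots> = 2 ^ (16 * s)"
      by (simp add: power_mult flip: power_mult_distrib)
    finally show ?thesis unfolding cV of_nat_le_iff[where 'a = real, symmetric] by simp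
  qed
  show ?thesis
  proof (intro exI[of _ w] conjI)
    show "l2_resistant V (\<lambda>x y. real (w (sym_diff x y))) (s / 20)"
    proof (rule l2_resistant_if_poincare[where I = ?I and \<tau> = "\<lambda>i x. sym_diff x (g i)", OF _ I(1,2)])
        show "finite V" by (simp add: V_def)
      show "real (w (sym_diff x y)) = 0 \<longleftrightarrow> x = y" for x y using w(2)[of "sym_diff x y"] by auto
      show "real (w (sym_diff x y)) = real (w (sym_diff y x))" for x y by (simp add: Un_commute)
      show "real (w (sym_diff x z)) \<le> real (w (sym_diff x y)) + real (w (sym_diff y z))" for x y z
      proof -
        have "sym_diff x z = sym_diff (sym_diff x y) (sym_diff y z)" by blast
        then show ?thesis using w(3)[of "sym_diff x y" "sym_diff y z"] by simp
      qed
      show "bij_betw (\<lambda>x. sym_diff x (g i)) V V" if "i \<in> ?I" for i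
        by (rule bij_betwI[where g = "\<lambda>x. sym_diff x (g i)"])
          (use g[OF that] in \<open>auto simp: V_def\<close>)
      show "real (w (sym_diff x (sym_diff x (g i)))) \<le> 1" if "i \<in> ?I" for i x
      proof -
        have "sym_diff x (sym_diff x (g i)) = xor_sum g {i}" by auto
        then show ?thesis using word_norm_le[OF I(1), of "{i}" g] that by (simp add: w_def)
      qed
      show "real (card ?I) * (\<Sum>x\<in>V. \<Sum>y\<in>V. (\<phi> x - \<phi> y)\<^sup>2)
          \<le> 4 * card V * (\<Sum>i\<in>?I. \<Sum>x\<in>V. (\<phi> (sym_diff x (g i)) - \<phi> x)\<^sup>2)" for \<phi> :: "nat set \<Rightarrow> real"
        using poincare_Pow[of ?A ?I g "8 * s" \<phi>, OF _ _ g gap] by (simp add: V_def card_Pow)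
      show "4 * card {y\<in>V. real (w (sym_diff x y)) \<le> s} \<le> card V" if "x \<in> V" for x
      proof -
        have "{y\<in>V. real (w (sym_diff x y)) \<le> s} \<subseteq> sym_diff x ` {v\<in>V. w v \<le> s}"
        proof
          fix y assume "y \<in> {y\<in>V. real (w (sym_diff x y)) \<le> s}"
          then show "y \<in> sym_diff x ` {v\<in>V. w v \<le> s}"
            using that by (intro image_eqI[of _ _ "sym_diff x y"]) (auto simp: V_def)
        qed
        then have "card {y\<in>V. real (w (sym_diff x y)) \<le> s} \<le> card {v\<in>V. w v \<le> s}"
          by (intro surj_card_le) (auto simp: V_def)
        then show ?thesis using ball by linarith
      qed
    qed simp_all
  qed (use w in auto)
qed

lemma exists_l2_resistant_metric:
  fixes s :: nat
  assumes s: "1 \<le> s"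
  defines "V \<equiv> {..<65536 ^ s}"
  shows "\<exists>\<rho> :: nat \<Rightarrow> nat \<Rightarrow> real. Metric_space V \<rho> \<and> (\<forall>x y. \<rho> x y \<le> 64 * s) \<and>
     (\<forall>x\<in>V. \<forall>y\<in>V. x \<noteq> y \<longrightarrow> 1 \<le> \<rho> x y) \<and> l2_resistant V \<rho> (s / 20)"
proof -
  let ?P = "Pow {..<16 * s}"
  obtain w where w: "\<And>v. w v \<le> 64 * s" "\<And>v. w v = 0 \<longleftrightarrow> v = {}"
      "\<And>u v. w (sym_diff u v) \<le> w u + w v"
    and hard: "l2_resistant ?P (\<lambda>x y. w (sym_diff x y)) (s / 20)"
    using exists_l2_resistant_norm[OF s] by blast
  have cP: "card ?P = card V"
    by (simp add: V_def card_Pow power_mult)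
  then obtain h where h: "bij_betw h V ?P"
    using finite_same_card_bij[of V ?P] by (auto simp: V_def)
  then have inj: "inj_on h V" by (simp add: bij_betw_def)
  define \<rho> where "\<rho> x y = real (w (sym_diff (h x) (h y)))" for x y
  have zero: "w (sym_diff (h x) (h y)) = 0 \<longleftrightarrow> x = y" if "x \<in> V" "y \<in> V" for x y
    using w(2)[of "sym_diff (h x) (h y)"] inj_on_eq_iff[OF inj that] by auto
  show ?thesis
  proof (intro exI[of _ \<rho>] conjI allI ballI impI)
    show "Metric_space V \<rho>"
    proof
      show "\<rho> x y = \<rho> y x" for x y by (simp add: \<rho>_def Un_commute)
      show "\<rho> x y = 0 \<longleftrightarrow> x = y" if "x \<in> V" "y \<in> V" for x y
        using zero[OF that] by (simp add: \<rho>_def)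
      show "\<rho> x z \<le> \<rho> x y + \<rho> y z" for x y z
      proof -
        have "sym_diff (h x) (h z) = sym_diff (sym_diff (h x) (h y)) (sym_diff (h y) (h z))" by blast
        then show ?thesis
          unfolding \<rho>_def using w(3)[of "sym_diff (h x) (h y)" "sym_diff (h y) (h z)"] by simp
      qed
    qed (simp add: \<rho>_def)
    show "\<rho> x y \<le> 64 * s" for x y
      unfolding \<rho>_def using w(1)[of "sym_diff (h x) (h y)"] by linarith
    show "1 \<le> \<rho> x y" if "x \<in> V" "y \<in> V" "x \<noteq> y" for x y
      unfolding \<rho>_def using zero[OF that(1,2)] that(3) by linarith
    show "l2_resistant V \<rho> (s / 20)"
    proof (rule l2_resistantI)
      fix S :: "nat set" and F :: "nat \<Rightarrow> nat \<Rightarrow> real" and A B :: real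
      assume S: "S \<subseteq> V" "3 * card V < 4 * card S" and F: "\<And>x. x \<in> S \<Longrightarrow> F x \<in> mspace l2"
        and AB: "0 \<le> A" "0 \<le> B"
        and upper: "\<And>x y. x \<in> S \<Longrightarrow> y \<in> S \<Longrightarrow> mdist l2 (F x) (F y) \<le> B * \<rho> x y"
        and lower: "\<And>x y. x \<in> S \<Longrightarrow> y \<in> S \<Longrightarrow> \<rho> x y \<le> A * mdist l2 (F x) (F y)"
      have injS: "inj_on h S" using inj S(1) by (rule inj_on_subset)
      define k where "k = inv_into S h"
      have k: "k (h x) = x" if "x \<in> S" for x
        unfolding k_def using injS that by (rule inv_into_f_f)
      show "s / 20 \<le> A * B"
      proof (rule l2_resistantD[OF hard, of "h ` S" "F \<circ> k"])
        show "h ` S \<subseteq> ?P" using S(1) h by (auto simp: bij_betw_def)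
        show "3 * card ?P < 4 * card (h ` S)" using S(2) injS cP by (simp add: card_image)
      qed (use F AB upper lower in \<open>auto simp: k \<rho>_def\<close>)
    qed
  qed
qed

section \<open>Iterating a metric on the digits\<close>

definition digit :: "nat \<Rightarrow> nat \<Rightarrow> nat \<Rightarrow> nat" where
  "digit N l x = x div N ^ l mod N"

text \<open>
  The number of low-order digits that have to be dropped to make the numbers equal, that is, one more
  than the position of the leading differing digit, and 0 for equal numbers.
\<close>

definition split_level :: "nat \<Rightarrow> nat \<Rightarrow> nat \<Rightarrow> nat" where
  "split_level N x y = (LEAST l. x div N ^ l = y div N ^ l)"

definition digit_dist :: "nat \<Rightarrow> real \<Rightarrow> (nat \<Rightarrow> nat \<Rightarrow> real) \<Rightarrow> nat \<Rightarrow> nat \<Rightarrow> real" where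
  "digit_dist N \<beta> \<rho> x y =
     (if x = y then 0
      else let l = split_level N x y - 1 in \<beta> ^ l * \<rho> (digit N l x) (digit N l y))"

lemma split_level_le_iff:
  assumes N: "2 \<le> N"
  shows "split_level N x y \<le> i \<longleftrightarrow> x div N ^ i = y div N ^ i"
proof
  have zero: "z div N ^ (x + y) = 0" if "z \<le> x + y" for z
  proof -
    have "x + y < N ^ (x + y)" using N by (intro power_gt_expt) auto
    then show ?thesis using that by simp
  qed
  have eq: "x div N ^ split_level N x y = y div N ^ split_level N x y"
    unfolding split_level_def by (rule LeastI[of _ "x + y"]) (simp add: zero)
  assume "split_level N x y \<le> i"
  then have "N ^ i = N ^ split_level N x y * N ^ (i - split_level N x y)"
    by (simp flip: power_add)
  then show "x div N ^ i = y div N ^ i" by (simp add: div_mult2_eq eq)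
qed (simp add: split_level_def Least_le)

lemma div_power_Suc_digit: "x div N ^ l = x div N ^ Suc l * N + digit N l x"
proof -
  have "x div N ^ Suc l = x div N ^ l div N" by (simp only: power_Suc2 div_mult2_eq)
  then show ?thesis unfolding digit_def by (metis div_mult_mod_eq)
qed

lemma split_level_refl [simp]: "2 \<le> N \<Longrightarrow> split_level N x x = 0"
  using split_level_le_iff[of N x x 0] by simp

lemma split_level_pos: "2 \<le> N \<Longrightarrow> x \<noteq> y \<Longrightarrow> 0 < split_level N x y"
  using split_level_le_iff[of N x y 0] by auto

lemma digit_dist_split_level:
  assumes "split_level N x y = Suc l" "2 \<le> N"
  shows "digit_dist N \<beta> \<rho> x y = \<beta> ^ l * \<rho> (digit N l x) (digit N l y)"
    and "digit N l x \<noteq> digit N l y"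
proof -
  have "x \<noteq> y" using assms by auto
  then show "digit_dist N \<beta> \<rho> x y = \<beta> ^ l * \<rho> (digit N l x) (digit N l y)"
    using assms by (simp add: digit_dist_def)
  have "x div N ^ Suc l = y div N ^ Suc l" "x div N ^ l \<noteq> y div N ^ l"
    using assms split_level_le_iff[OF assms(2), of x y "Suc l"]
      split_level_le_iff[OF assms(2), of x y l] by auto
  then show "digit N l x \<noteq> digit N l y"
    using div_power_Suc_digit[of x N l] div_power_Suc_digit[of y N l] by auto
qed

text \<open>
  Numbers with a common prefix above position \<open>l\<close>, no two of which share the digit there, form a copy
  of a subset of \<open>\<rho>\<close> scaled by \<open>\<beta> ^ l\<close>.
\<close>

lemma digit_dist_same_block:
  assumes N: "2 \<le> N" and \<rho>: "\<And>a. a < N \<Longrightarrow> \<rho> a a = 0"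
    and block: "x div N ^ Suc l = y div N ^ Suc l"
    and eq: "digit N l x = digit N l y \<Longrightarrow> x = y"
  shows "digit_dist N \<beta> \<rho> x y = \<beta> ^ l * \<rho> (digit N l x) (digit N l y)"
proof (cases "x = y")
  case True
  then show ?thesis using \<rho>[of "digit N l y"] N by (simp add: digit_dist_def digit_def)
next
  case False
  then have "x div N ^ l \<noteq> y div N ^ l"
    using eq by (auto simp: digit_def)
  then have "split_level N x y = Suc l"
    using split_level_le_iff[OF N, of x y "Suc l"] split_level_le_iff[OF N, of x y l] block by simp
  then show ?thesis using N by (rule digit_dist_split_level)
qed

text \<open>
  The split level is an ultrametric. If \<open>x, y\<close> or \<open>y, z\<close> is the pair that splits at the lowest
  position, the other two sides are equal; if all three pairs split at the same position, the triangle
  inequality is that of \<open>\<rho>\<close>. If \<open>x, z\<close> splits at a lower position than the two other pairs, it has a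
  smaller power of \<open>\<beta>\<close> as its scale, and since \<open>\<beta>\<close> bounds the diameter of \<open>\<rho>\<close>, its distance is at
  most the scale of the other two sides.
\<close>

lemma Metric_space_digit_dist:
  assumes N: "2 \<le> N" and \<rho>: "Metric_space {..<N} \<rho>"
    and lb: "\<And>a b. a < N \<Longrightarrow> b < N \<Longrightarrow> a \<noteq> b \<Longrightarrow> 1 \<le> \<rho> a b"
    and ub: "\<And>a b. a < N \<Longrightarrow> b < N \<Longrightarrow> \<rho> a b \<le> \<beta>" and \<beta>: "1 \<le> \<beta>"
  shows "Metric_space UNIV (digit_dist N \<beta> \<rho>)"
proof -
  interpret \<rho>: Metric_space "{..<N}" \<rho> by (rule \<rho>)
  have dig [simp]: "digit N l x < N" for l x using N by (simp add: digit_def)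
  let ?d = "digit_dist N \<beta> \<rho>" and ?L = "split_level N"
  have comm: "?L x y = ?L y x" for x y
    unfolding split_level_def by (intro arg_cong[of _ _ Least]) auto
  have nonneg: "0 \<le> ?d x y" for x y
    using \<beta> by (auto simp: digit_dist_def Let_def)
  have sym: "?d x y = ?d y x" for x y
    by (simp add: digit_dist_def comm[of x y] \<rho>.commute Let_def)
  have lower: "\<beta> ^ l \<le> ?d x y" if "?L x y = Suc l" for x y l
    using digit_dist_split_level[OF that N] lb[of "digit N l x" "digit N l y"] \<beta>
    by simp
  have upper: "?d x y \<le> \<beta> ^ l" if "?L x y \<le> l" for x y l
  proof (cases "?L x y")
    case 0
    then have "x = y" using split_level_pos[OF N, of x y] by auto
    then show ?thesis using \<beta> by (simp add: digit_dist_def)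
  next
    case (Suc k)
    have "?d x y \<le> \<beta> ^ k * \<beta>"
      unfolding digit_dist_split_level(1)[OF Suc N] using ub \<beta> by (intro mult_left_mono) auto
    also have "\<dots> = \<beta> ^ Suc k" by simp
    also have "\<dots> \<le> \<beta> ^ l" using that Suc \<beta> by (intro power_increasing) auto
    finally show ?thesis .
  qed
  have ultra: "?L x z \<le> max (?L x y) (?L y z)" for x y z
    using split_level_le_iff[OF N, of x y "max (?L x y) (?L y z)"]
      split_level_le_iff[OF N, of y z "max (?L x y) (?L y z)"]
    by (simp add: split_level_le_iff[OF N, of x z])
  have same: "?d x z = ?d y z" if "?L x y \<le> l" "?L y z = Suc l" for x y z l
  proof -
    have e: "x div N ^ l = y div N ^ l"
      using that split_level_le_iff[OF N] by blast
    have "?L x z = Suc l"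
      using ultra[of x z y] ultra[of y z x] that comm[of x y] by auto
    then show ?thesis
      using digit_dist_split_level(1)[OF that(2) N] digit_dist_split_level(1)[of N x z l] N e
      by (simp add: digit_def)
  qed
  show ?thesis
  proof
    show "?d x y = 0 \<longleftrightarrow> x = y" for x y
    proof
      assume "?d x y = 0"
      then show "x = y"
        using lower[of x y "?L x y - 1"] split_level_pos[OF N, of x y] \<beta>
        by (metis One_nat_def Suc_pred not_one_le_zero one_le_power order_trans)
    qed (simp add: digit_dist_def)
    fix x y z
    consider "?L x y < ?L y z" | "?L y z < ?L x y" | "?L x y = ?L y z" by linarith
    then show "?d x z \<le> ?d x y + ?d y z"
    proof cases
      case 1
      then obtain l where "?L y z = Suc l" by (cases "?L y z") auto
      then show ?thesis using same[of x y l z] 1 nonneg[of x y] by simp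
    next
      case 2
      then obtain l where "?L x y = Suc l" by (cases "?L x y") auto
      then show ?thesis
        using same[of z y l x] 2 nonneg[of y z] sym comm by simp
    next
      case 3
      show ?thesis
      proof (cases "?L x y")
        case 0
        then show ?thesis
          using 3 split_level_pos[OF N, of x y] split_level_pos[OF N, of y z] nonneg[of x y]
          by (cases "x = y"; cases "y = z") auto
      next
        case (Suc l)
        note yz = 3[symmetric, unfolded Suc]
        show ?thesis
        proof (cases "?L x z = Suc l")
          case True
          have "\<rho> (digit N l x) (digit N l z)
              \<le> \<rho> (digit N l x) (digit N l y) + \<rho> (digit N l y) (digit N l z)"
            by (intro \<rho>.triangle) auto
          then show ?thesis
            unfolding digit_dist_split_level(1)[OF True N] digit_dist_split_level(1)[OF Suc N]
              digit_dist_split_level(1)[OF yz N]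
            using \<beta> by (simp flip: distrib_left)
        next
          case False
          then have "?L x z \<le> l" using ultra[of x z y] Suc yz by simp
          then show ?thesis using upper[of x z l] lower[OF Suc] nonneg[of y z] by linarith
        qed
      qed
    qed
  qed (use nonneg sym in auto)
qed

text \<open>
  The numbers in \<open>T\<close> with a given prefix form a tree of depth \<open>k\<close> in which each node has at most \<open>M\<close>
  children.
\<close>

lemma card_le_power_of_digits:
  assumes T: "finite T"
    and M: "\<And>l p. card (digit N l ` {x\<in>T. x div N ^ Suc l = p}) \<le> M"
  shows "card {x\<in>T. x div N ^ k = p} \<le> M ^ k"
proof (induction k arbitrary: p)
  case 0
  have "{x\<in>T. x div N ^ 0 = p} \<subseteq> {p}" by auto
  then show ?case using card_mono[of "{p}"] by fastforce
next
  case (Suc k)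
  let ?D = "digit N k ` {x\<in>T. x div N ^ Suc k = p}"
  have "{x\<in>T. x div N ^ Suc k = p} \<subseteq> (\<Union>c\<in>?D. {x\<in>T. x div N ^ k = p * N + c})"
    using div_power_Suc_digit[of _ N k] by auto
  then have "card {x\<in>T. x div N ^ Suc k = p} \<le> card (\<Union>c\<in>?D. {x\<in>T. x div N ^ k = p * N + c})"
    using T by (intro card_mono) auto
  also have "\<dots> \<le> (\<Sum>c\<in>?D. card {x\<in>T. x div N ^ k = p * N + c})"
    using T by (intro card_UN_le) auto
  also have "\<dots> \<le> (\<Sum>c\<in>?D. M ^ k)" by (intro sum_mono Suc.IH)
  also have "\<dots> \<le> M ^ Suc k" using M[of k p] by simp
  finally show ?case .
qed

text \<open>
  One number for each digit gives a copy of the set of digits, scaled by \<open>\<beta> ^ l\<close>. Scaling multiplies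
  one Lipschitz constant and divides the other, so the distortion is the same and \<open>hard\<close> applies.
\<close>

lemma card_digits_of_embedded:
  fixes \<rho> :: "nat \<Rightarrow> nat \<Rightarrow> real"
  assumes N: "2 \<le> N" and \<rho>: "Metric_space {..<N} \<rho>" and \<beta>: "0 < \<beta>"
    and hard: "l2_resistant {..<N} \<rho> D"
    and f: "f ` T \<subseteq> mspace l2" and AB: "0 \<le> A" "0 \<le> B" "A * B < D"
    and bounds: "\<And>x y. x \<in> T \<Longrightarrow> y \<in> T \<Longrightarrow> mdist l2 (f x) (f y) \<le> B * digit_dist N \<beta> \<rho> x y \<and>
        digit_dist N \<beta> \<rho> x y \<le> A * mdist l2 (f x) (f y)"
  shows "4 * card (digit N l ` {x\<in>T. x div N ^ Suc l = p}) \<le> 3 * N"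
proof (rule ccontr)
  let ?B = "{x\<in>T. x div N ^ Suc l = p}" and ?S = "digit N l ` {x\<in>T. x div N ^ Suc l = p}"
  assume large: "\<not> 4 * card ?S \<le> 3 * N"
  define r where "r = inv_into ?B (digit N l)"
  have r: "r c \<in> T" "r c div N ^ Suc l = p" "digit N l (r c) = c" if "c \<in> ?S" for c
    using inv_into_into[OF that] f_inv_into_f[OF that] by (auto simp: r_def)
  have dist: "digit_dist N \<beta> \<rho> (r c) (r d) = \<beta> ^ l * \<rho> c d" if "c \<in> ?S" "d \<in> ?S" for c d
    using digit_dist_same_block[of N \<rho> "r c" l "r d" \<beta>] r[OF that(1)] r[OF that(2)] N
      Metric_space.mdist_zero[OF \<rho>] by force
  have "D \<le> (A / \<beta> ^ l) * (B * \<beta> ^ l)"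
  proof (rule l2_resistantD[OF hard, of ?S "f \<circ> r"])
    show "?S \<subseteq> {..<N}" using N by (auto simp: digit_def)
    fix c d assume cd: "c \<in> ?S" "d \<in> ?S"
    note b = bounds[OF r(1)[OF cd(1)] r(1)[OF cd(2)], unfolded dist[OF cd]]
    show "mdist l2 ((f \<circ> r) c) ((f \<circ> r) d) \<le> B * \<beta> ^ l * \<rho> c d" using b by (simp add: mult_ac)
    show "\<rho> c d \<le> A / \<beta> ^ l * mdist l2 ((f \<circ> r) c) ((f \<circ> r) d)"
      using b \<beta> by (simp add: field_simps)
  qed (use large AB \<beta> f r(1) in auto)
  then show False using AB \<beta> by simp
qed

text \<open>
  The numbers below \<open>n\<close> meet at most \<open>n div N ^ k + 1\<close> blocks of \<open>N ^ k\<close> numbers.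
\<close>

lemma card_le_of_digits:
  assumes T: "T \<subseteq> {..<n}"
    and M: "\<And>l p. card (digit N l ` {x\<in>T. x div N ^ Suc l = p}) \<le> M"
  shows "card T \<le> (n div N ^ k + 1) * M ^ k"
proof -
  have finT: "finite T" using T finite_subset by blast
  have "T \<subseteq> (\<Union>p\<le>n div N ^ k. {x\<in>T. x div N ^ k = p})"
    using T by (force intro: div_le_mono less_imp_le)
  then have "card T \<le> card (\<Union>p\<le>n div N ^ k. {x\<in>T. x div N ^ k = p})"
    using finT by (intro card_mono) auto
  also have "\<dots> \<le> (\<Sum>p\<le>n div N ^ k. card {x\<in>T. x div N ^ k = p})"
    by (rule card_UN_le) simp
  also have "\<dots> \<le> (\<Sum>p\<le>n div N ^ k. M ^ k)"
    by (intro sum_mono card_le_power_of_digits[OF finT M])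
  finally show ?thesis by simp
qed

text \<open>
  Since \<open>Suc k\<close> is greater than \<open>ln n / ln N\<close> and \<open>ln N\<close> is at most proportional to \<open>\<alpha>\<close>, the
  left-hand side is exponentially small in \<open>ln n / \<alpha>\<close>.
\<close>

lemma three_quarters_power_le_powr:
  fixes n N :: nat and L \<alpha> :: real
  assumes n: "1 \<le> n" "n < N ^ Suc k" and N: "ln (real N) \<le> L * \<alpha>" "0 < N" and pos: "0 < L" "0 < \<alpha>"
  shows "(3 / 4) ^ Suc k \<le> real n powr (- (ln (4 / 3) / L / \<alpha>))"
proof -
  have "real n \<le> real N ^ Suc k"
    using n(2) by (metis less_imp_le of_nat_le_iff of_nat_power)
  then have "ln (real n) \<le> ln (real N ^ Suc k)" using n(1) by simp
  also have "\<dots> = Suc k * ln (real N)" using N(2) by (subst ln_realpow) auto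
  also have "\<dots> \<le> Suc k * (L * \<alpha>)" using N(1) by (rule mult_left_mono) simp
  finally have "ln (4 / 3) / L / \<alpha> * ln (real n) \<le> ln (4 / 3) / L / \<alpha> * (Suc k * (L * \<alpha>))"
    using pos by (intro mult_left_mono) auto
  also have "\<dots> = Suc k * ln (4 / 3)" using pos by simp
  finally have "exp (- (Suc k * ln (4 / 3))) \<le> real n powr (- (ln (4 / 3) / L / \<alpha>))"
    using n by (simp add: powr_def)
  moreover have "exp (- (Suc k * ln (4 / 3 :: real))) = (3 / 4) ^ Suc k"
  proof -
    have "exp (- (Suc k * ln (4 / 3 :: real))) = exp (- ln (4 / 3)) ^ Suc k"
      by (subst exp_of_nat_mult[symmetric]) simp
    then show ?thesis by (simp add: exp_minus)
  qed
  ultimately show ?thesis by simp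
qed

text \<open>
  The base \<open>N\<close> is taken with \<open>ln N = 16 * s * ln 2\<close> and \<open>30 * \<alpha> \<le> s \<le> 31 * \<alpha>\<close>, whence the
  constant \<open>496 = 16 * 31\<close>. The factor 8/3 is 2, for the incomplete block of length \<open>N ^ k\<close>, times
  4/3, for passing from \<open>(3 / 4) ^ k\<close> to \<open>(3 / 4) ^ Suc k\<close>, the power that \<open>n < N ^ Suc k\<close> controls.
\<close>

lemma exists_space_without_large_l2_subspaces:
  fixes \<alpha> :: real and n :: nat
  assumes \<alpha>: "2 < \<alpha>" and n: "1 \<le> n"
  obtains X :: "nat metric" where "mspace X = {..<n}"
    "\<And>m. has_embedding_subspace {l2} \<alpha> m X
       \<Longrightarrow> real m \<le> 8 / 3 * real n powr (1 - ln (4 / 3) / (496 * ln 2) / \<alpha>)"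
proof -
  define s where "s = nat \<lceil>30 * \<alpha>\<rceil>"
  have s: "30 * \<alpha> \<le> s" "s \<le> 31 * \<alpha>" "1 \<le> s"
  proof -
    have "real s = real_of_int \<lceil>30 * \<alpha>\<rceil>" using \<alpha> by (simp add: s_def)
    then show "30 * \<alpha> \<le> s" "s \<le> 31 * \<alpha>" using \<alpha> by linarith+
    then show "1 \<le> s" using \<alpha> by linarith
  qed
  define N :: nat where "N = 65536 ^ s"
  have "65536 ^ 1 \<le> N" unfolding N_def using s(3) by (intro power_increasing) auto
  then have N: "2 \<le> N" by simp
  obtain \<rho> :: "nat \<Rightarrow> nat \<Rightarrow> real" where \<rho>: "Metric_space {..<N} \<rho>"
    and ub: "\<And>x y. \<rho> x y \<le> 64 * s"
    and lb: "\<And>x y. x \<in> {..<N} \<Longrightarrow> y \<in> {..<N} \<Longrightarrow> x \<noteq> y \<Longrightarrow> 1 \<le> \<rho> x y"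
    and hard: "l2_resistant {..<N} \<rho> (s / 20)"
    using exists_l2_resistant_metric[OF s(3), folded N_def] by blast
  let ?d = "digit_dist N (64 * s) \<rho>"
  have "Metric_space UNIV ?d"
    using N \<rho> lb ub s(3) by (intro Metric_space_digit_dist) auto
  then have d: "Metric_space {..<n} ?d" by (rule Metric_space.subspace) simp
  define X where "X = metric ({..<n}, ?d)"
  have X: "mspace X = {..<n}" "mdist X = ?d"
    unfolding X_def by (rule Metric_space.mspace_metric[OF d] Metric_space.mdist_metric[OF d])+
  obtain k where k: "N ^ k \<le> n" "n < N ^ Suc k"
    using ex_power_ivl1[of N n] N n by auto
  show ?thesis
  proof (rule that[OF X(1)])
    fix m assume "has_embedding_subspace {l2} \<alpha> m X"
    then obtain T where T: "T \<subseteq> {..<n}" "card T = m" and e: "embeds_class \<alpha> (submetric X T) {l2}"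
      by (auto simp: has_embedding_subspace_def X)
    have finT: "finite T" using T(1) finite_subset by blast
    have Y: "mspace (submetric X T) = T" "mdist (submetric X T) = ?d" using T(1) X by auto
    have few: "4 * card (digit N l ` {x\<in>T. x div N ^ Suc l = p}) \<le> 3 * N" for l p
    proof (cases "\<exists>x\<in>T. \<exists>y\<in>T. x \<noteq> y")
      case True
      then obtain x0 y0 where ne: "x0 \<in> T" "y0 \<in> T" "x0 \<noteq> y0" by blast
      \<comment> \<open>The factor 3/2 absorbs the infimum in the definition of embeddability and still leaves \<open>20 * (3 / 2 * \<alpha>) \<le> s\<close>.\<close>
      obtain f A B where f: "f ` T \<subseteq> mspace l2" "0 \<le> A" "0 \<le> B" "A * B < 3 / 2 * \<alpha>"
        "\<And>x y. x \<in> T \<Longrightarrow> y \<in> T \<Longrightarrow> mdist l2 (f x) (f y) \<le> B * ?d x y \<and> ?d x y \<le> A * mdist l2 (f x) (f y)"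
        using bilipschitz_of_embeds_class[OF e, of x0 y0 "3 / 2 * \<alpha>"] \<alpha> ne unfolding Y by auto
      show ?thesis
      proof (rule card_digits_of_embedded[OF N \<rho> _ _ f(1-3) _ f(5)])
        show "A * B < s / 20" using f(4) s(1) by linarith
      qed (use s(3) hard in auto)
    next
      case False
      then have "card (digit N l ` {x\<in>T. x div N ^ Suc l = p}) \<le> 1"
        by (intro card_le_Suc0_iff_eq[THEN iffD2, folded One_nat_def]) (use finT in auto)
      then show ?thesis using N by linarith
    qed
    have "4 dvd N" unfolding N_def using s(3) by (intro dvd_trans[OF _ dvd_power]) auto
    then obtain M where M: "N = 4 * M" by blast
    have digits: "card (digit N l ` {x\<in>T. x div N ^ Suc l = p}) \<le> 3 * M" for l p
    proof -
      have "4 * card (digit N l ` {x\<in>T. x div N ^ Suc l = p}) \<le> 3 * (4 * M)"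
        using few M by metis
      then show ?thesis by linarith
    qed
    let ?q = "n div N ^ k"
    have "1 \<le> ?q" using k(1) N by (simp add: Suc_le_eq div_greater_zero_iff)
    have "m \<le> (?q + 1) * (3 * M) ^ k"
      using card_le_of_digits[OF T(1) digits, of k] T(2) by simp
    also have "\<dots> \<le> (2 * ?q) * (3 * M) ^ k"
      using \<open>1 \<le> ?q\<close> by (intro mult_le_mono1) simp
    finally have "real m \<le> real ((2 * ?q) * (3 * M) ^ k)" by (simp only: of_nat_le_iff)
    also have "\<dots> = 2 * (real ?q * real N ^ k) * (3 / 4) ^ k"
      by (simp add: M power_mult_distrib power_divide)
    also have "\<dots> \<le> 2 * real n * (3 / 4) ^ k"
    proof -
      have "?q * N ^ k \<le> n" by simp
      then have "real ?q * real N ^ k \<le> real n" by (metis of_nat_le_iff of_nat_mult of_nat_power)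
      then show ?thesis by (intro mult_right_mono mult_left_mono) auto
    qed
    also have "\<dots> = 8 / 3 * (real n * (3 / 4) ^ Suc k)" by simp
    also have "\<dots> \<le> 8 / 3 * (real n * real n powr (- (ln (4 / 3) / (496 * ln 2) / \<alpha>)))"
    proof (rule mult_left_mono, rule mult_left_mono)
      have "ln (real N) = s * (16 * ln 2)"
      proof -
        have "real N = (2 ^ 16) ^ s" by (simp add: N_def)
        then show ?thesis by (simp only: ln_realpow zero_less_power zero_less_numeral)
      qed
      also have "\<dots> \<le> (31 * \<alpha>) * (16 * ln 2)"
        using s(2) by (rule mult_right_mono) simp
      also have "\<dots> = (496 * ln 2) * \<alpha>" by simp
      finally have lnN: "ln (real N) \<le> (496 * ln 2) * \<alpha>" .
      show "(3 / 4) ^ Suc k \<le> real n powr (- (ln (4 / 3) / (496 * ln 2) / \<alpha>))"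
        by (rule three_quarters_power_le_powr[OF n k(2) lnN]) (use N \<alpha> in auto)
    qed simp_all
    also have "\<dots> = 8 / 3 * real n powr (1 - ln (4 / 3) / (496 * ln 2) / \<alpha>)"
      using n powr_add[of "real n" 1 "- (ln (4 / 3) / (496 * ln 2) / \<alpha>)"] by simp
    finally show "real m \<le> 8 / 3 * real n powr (1 - ln (4 / 3) / (496 * ln 2) / \<alpha>)" .
  qed
qed

lemma has_embedding_subspace_0:
  assumes "\<M> \<noteq> {}" "1 \<le> \<alpha>"
  shows "has_embedding_subspace \<M> \<alpha> 0 X"
proof -
  obtain Y where "Y \<in> \<M>" using assms by blast
  moreover have "least_distortion Y (submetric X {}) \<le> 1"
    unfolding least_distortion_def
    by (rule INF_lower2[of undefined]) (auto simp: embeddings_def distortion_def)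
  then have "embeds_class \<alpha> (submetric X {}) {Y}"
    using assms(2) by (simp add: embeds_class_def least_distortion_class_def order_trans)
  ultimately show ?thesis unfolding has_embedding_subspace_def by (intro exI[of _ "{}"]) auto
qed

definition universally_embeds :: "'b metric set \<Rightarrow> real \<Rightarrow> nat \<Rightarrow> nat \<Rightarrow> bool" where
  "universally_embeds \<M> \<alpha> n m \<longleftrightarrow>
     (\<forall>X :: nat metric. finite (mspace X) \<and> card (mspace X) = n \<longrightarrow> has_embedding_subspace \<M> \<alpha> m X)"

lemma metric_Ramsey_eq: "metric_Ramsey \<M> \<alpha> n = (GREATEST m. universally_embeds \<M> \<alpha> n m)"
  by (simp add: metric_Ramsey_def universally_embeds_def)

theorem theorem1p5:
  shows "\<exists>c C :: real. c > 0 \<and> C > 0 \<and>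
    (\<forall>(\<alpha>::real) (n::nat). \<alpha> > 2 \<and> n \<ge> 1 \<longrightarrow>
       metric_Ramsey UM \<alpha> n \<le> metric_Ramsey {l2} \<alpha> n \<and>
       real (metric_Ramsey {l2} \<alpha> n) \<le> C * real n powr (1 - c / \<alpha>))"
proof (rule exI[of _ "ln (4 / 3) / (496 * ln 2)"], rule exI[of _ "8 / 3"], intro conjI allI impI)
  fix \<alpha> :: real and n :: nat
  assume \<alpha>n: "\<alpha> > 2 \<and> n \<ge> 1"
  obtain X :: "nat metric" where X: "mspace X = {..<n}"
    and le: "\<And>m. has_embedding_subspace {l2} \<alpha> m X
       \<Longrightarrow> real m \<le> 8 / 3 * real n powr (1 - ln (4 / 3) / (496 * ln 2) / \<alpha>)"
    using exists_space_without_large_l2_subspaces \<alpha>n by metis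
  have le_n: "m \<le> n" if "universally_embeds {l2} \<alpha> n m" for m
  proof -
    have "has_embedding_subspace {l2} \<alpha> m X"
      using that X by (simp add: universally_embeds_def)
    then obtain S where "S \<subseteq> {..<n}" "card S = m"
      unfolding has_embedding_subspace_def X by blast
    then show ?thesis using card_mono[of "{..<n}" S] by simp
  qed
  have UM_l2: "universally_embeds {l2} \<alpha> n m" if "universally_embeds UM \<alpha> n m" for m
    using that has_embedding_subspace_UM_imp_l2 unfolding universally_embeds_def by blast
  have "metric ({}, \<lambda>_ _ :: nat. 0) \<in> UM"
    by (simp add: ultrametrics_def Metric_space.mspace_metric Metric_space_def)
  then have "UM \<noteq> {}" by blast
  then have "universally_embeds UM \<alpha> n 0"
    using \<alpha>n unfolding universally_embeds_def by (simp add: has_embedding_subspace_0)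
  then have UM: "universally_embeds UM \<alpha> n (metric_Ramsey UM \<alpha> n)"
    unfolding metric_Ramsey_eq
  proof (rule GreatestI_nat)
    show "m \<le> n" if "universally_embeds UM \<alpha> n m" for m
      using le_n[OF UM_l2[OF that]] .
  qed
  have l2: "universally_embeds {l2} \<alpha> n (metric_Ramsey {l2} \<alpha> n)"
    unfolding metric_Ramsey_eq[of "{l2}"]
    by (rule GreatestI_nat[where P = "universally_embeds {l2} \<alpha> n", OF UM_l2[OF UM] le_n])
  show "metric_Ramsey UM \<alpha> n \<le> metric_Ramsey {l2} \<alpha> n"
    unfolding metric_Ramsey_eq[of "{l2}"]
    by (rule Greatest_le_nat[where P = "universally_embeds {l2} \<alpha> n", OF UM_l2[OF UM] le_n])
  have "has_embedding_subspace {l2} \<alpha> (metric_Ramsey {l2} \<alpha> n) X"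
    using l2 X by (simp add: universally_embeds_def)
  then show "real (metric_Ramsey {l2} \<alpha> n) \<le> 8 / 3 * real n powr (1 - ln (4 / 3) / (496 * ln 2) / \<alpha>)"
    by (rule le)
qed (simp_all add: divide_pos_pos)

end
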